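(* Let $K$ be a field of characteristic zero, $R=K[X_1,\ldots,X_n]$, and let $M$ be a holonomic left $A_n(K)$-module. Then \[\dim_K H^n(\partial_1,\ldots,\partial_n;M)\ge \sharp\,\mathrm{mIso}_R(M).\]
   Context: $A_n(K)=K\langle X_1,\ldots,X_n,\partial_1,\ldots,\partial_n\rangle$ is the Weyl algebra, containing $R$. The set $\mathrm{Ass}_R(M)$ of associated primes of $M$ as an $R$-module is finite. A prime $P$ is a maximal isolated associated prime of $M$ if $P$ is a maximal ideal of $R$ and also a minimal prime of $M$ (minimal in $\mathrm{Ass}_R(M)$); $\mathrm{mIso}_R(M)$ denotes the set of these. $H^n(\partial_1,\ldots,\partial_n;M)=M/(\partial_1M+\cdots+\partial_nM)$ is the top De Rham cohomology of $M$ (top cohomology of the Koszul cochain complex of $M$ with respect to $\partial_1,\ldots,\partial_n$). *)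

theory Defs
  imports Main "HOL.Vector_Spaces" "HOL-Library.Poly_Mapping"
begin

text \<open>Left modules over the Weyl algebra A_n(K) = K<X_i, d_i | i in 'n>, given by
  generators and relations: M is a K-vector space (scalar multiplication scale) with
  K-linear operators x i (multiplication by X_i) and d i (action of partial_i) satisfying
  [X_i,X_j] = 0, [d_i,d_j] = 0, [d_i,X_j] = delta_ij.\<close>

definition weyl_module ::
  "('k::field \<Rightarrow> 'm::ab_group_add \<Rightarrow> 'm) \<Rightarrow> ('n \<Rightarrow> 'm \<Rightarrow> 'm) \<Rightarrow> ('n \<Rightarrow> 'm \<Rightarrow> 'm) \<Rightarrow> bool" where
  "weyl_module scale x d \<longleftrightarrow>
     vector_space scale \<and>
     (\<forall>i. Vector_Spaces.linear scale scale (x i)) \<and> (\<forall>i. Vector_Spaces.linear scale scale (d i)) \<and>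
     (\<forall>i j m. x i (x j m) = x j (x i m)) \<and>
     (\<forall>i j m. d i (d j m) = d j (d i m)) \<and>
     (\<forall>i j m. d i (x j m) = x j (d i m) + (if i = j then m else 0))"

fun gen_act :: "('n \<Rightarrow> 'm \<Rightarrow> 'm) \<Rightarrow> ('n \<Rightarrow> 'm \<Rightarrow> 'm) \<Rightarrow> 'n + 'n \<Rightarrow> 'm \<Rightarrow> 'm" where
  "gen_act x d (Inl i) = x i"
| "gen_act x d (Inr i) = d i"

definition word_act :: "('n \<Rightarrow> 'm \<Rightarrow> 'm) \<Rightarrow> ('n \<Rightarrow> 'm \<Rightarrow> 'm) \<Rightarrow> ('n + 'n) list \<Rightarrow> 'm \<Rightarrow> 'm" where
  "word_act x d ws m = foldr (gen_act x d) ws m"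

definition bernstein_filt ::
  "('k::field \<Rightarrow> 'm::ab_group_add \<Rightarrow> 'm) \<Rightarrow> ('n \<Rightarrow> 'm \<Rightarrow> 'm) \<Rightarrow> ('n \<Rightarrow> 'm \<Rightarrow> 'm)
     \<Rightarrow> 'm set \<Rightarrow> nat \<Rightarrow> 'm set" where
  "bernstein_filt scale x d G k =
     module.span scale {word_act x d ws g | ws g. length ws \<le> k \<and> g \<in> G}"

text \<open>Holonomic: finitely generated, and the good (Bernstein) filtration F_k = B_k G has
  dim_K F_k bounded by C k^n, i.e. the Hilbert polynomial has degree (= d(M)) at most n.
  By Bernstein's inequality this is the same as d(M) = n or M = 0.\<close>
definition holonomic ::
  "('k::field \<Rightarrow> 'm::ab_group_add \<Rightarrow> 'm) \<Rightarrow> ('n::finite \<Rightarrow> 'm \<Rightarrow> 'm) \<Rightarrow> ('n \<Rightarrow> 'm \<Rightarrow> 'm) \<Rightarrow> bool" where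
  "holonomic scale x d \<longleftrightarrow>
     weyl_module scale x d \<and>
     (\<exists>G. finite G \<and>
        module.span scale {word_act x d ws g | ws g. g \<in> G} = UNIV \<and>
        (\<exists>C::nat. \<forall>k\<ge>1. (vector_space.dim scale (bernstein_filt scale x d G k))
                              \<le> C * k ^ card (UNIV :: 'n set)))"

definition mono_act :: "('n::finite \<Rightarrow> 'm \<Rightarrow> 'm) \<Rightarrow> ('n \<Rightarrow>\<^sub>0 nat) \<Rightarrow> 'm \<Rightarrow> 'm" where
  "mono_act x \<mu> = Finite_Set.fold (\<lambda>i f. (x i ^^ Poly_Mapping.lookup \<mu> i) \<circ> f) id (UNIV :: 'n set)"

definition poly_act ::
  "('k::field \<Rightarrow> 'm::ab_group_add \<Rightarrow> 'm) \<Rightarrow> ('n::finite \<Rightarrow> 'm \<Rightarrow> 'm)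
     \<Rightarrow> (('n \<Rightarrow>\<^sub>0 nat) \<Rightarrow>\<^sub>0 'k) \<Rightarrow> 'm \<Rightarrow> 'm" where
  "poly_act scale x p m = (\<Sum>\<mu>\<in>Poly_Mapping.keys p. scale (Poly_Mapping.lookup p \<mu>) (mono_act x \<mu> m))"

definition R_ann ::
  "('k::field \<Rightarrow> 'm::ab_group_add \<Rightarrow> 'm) \<Rightarrow> ('n::finite \<Rightarrow> 'm \<Rightarrow> 'm) \<Rightarrow> 'm
     \<Rightarrow> (('n \<Rightarrow>\<^sub>0 nat) \<Rightarrow>\<^sub>0 'k) set" where
  "R_ann scale x m = {p. poly_act scale x p m = 0}"

definition is_ideal :: "'a::comm_ring_1 set \<Rightarrow> bool" where
  "is_ideal I \<longleftrightarrow> 0 \<in> I \<and> (\<forall>a\<in>I. \<forall>b\<in>I. a + b \<in> I) \<and> (\<forall>a\<in>I. \<forall>r. r * a \<in> I)"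

definition prime_ideal :: "'a::comm_ring_1 set \<Rightarrow> bool" where
  "prime_ideal P \<longleftrightarrow> is_ideal P \<and> 1 \<notin> P \<and> (\<forall>a b. a * b \<in> P \<longrightarrow> a \<in> P \<or> b \<in> P)"

definition maximal_ideal :: "'a::comm_ring_1 set \<Rightarrow> bool" where
  "maximal_ideal P \<longleftrightarrow> is_ideal P \<and> 1 \<notin> P \<and>
     (\<forall>J. is_ideal J \<and> P \<subseteq> J \<longrightarrow> J = P \<or> 1 \<in> J)"

definition Ass_R ::
  "('k::field \<Rightarrow> 'm::ab_group_add \<Rightarrow> 'm) \<Rightarrow> ('n::finite \<Rightarrow> 'm \<Rightarrow> 'm)
     \<Rightarrow> (('n \<Rightarrow>\<^sub>0 nat) \<Rightarrow>\<^sub>0 'k) set set" where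
  "Ass_R scale x = {P. prime_ideal P \<and> (\<exists>m. P = R_ann scale x m)}"

definition mIso_R ::
  "('k::field \<Rightarrow> 'm::ab_group_add \<Rightarrow> 'm) \<Rightarrow> ('n::finite \<Rightarrow> 'm \<Rightarrow> 'm)
     \<Rightarrow> (('n \<Rightarrow>\<^sub>0 nat) \<Rightarrow>\<^sub>0 'k) set set" where
  "mIso_R scale x = {P \<in> Ass_R scale x. maximal_ideal P \<and>
                        (\<forall>Q\<in>Ass_R scale x. Q \<subseteq> P \<longrightarrow> Q = P)}"

definition dR_image ::
  "('n::finite \<Rightarrow> 'm::ab_group_add \<Rightarrow> 'm) \<Rightarrow> 'm set" where
  "dR_image d = {\<Sum>i\<in>UNIV. d i (f i) | f. True}"

text \<open>B is a finite set mapping bijectively onto a K-basis of the quotient M/N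
  (so that card B = dim_K (M/N)).\<close>
definition quot_basis ::
  "('k::field \<Rightarrow> 'm::ab_group_add \<Rightarrow> 'm) \<Rightarrow> 'm set \<Rightarrow> 'm set \<Rightarrow> bool" where
  "quot_basis scale N B \<longleftrightarrow> finite B \<and> module.span scale (N \<union> B) = UNIV \<and>
     (\<forall>c. (\<Sum>b\<in>B. scale (c b) b) \<in> N \<longrightarrow> (\<forall>b\<in>B. c b = 0))"

end

theory Submission
  imports Defs "HOL-Computational_Algebra.Polynomial"
begin

text \<open>For a maximal isolated prime \<open>P\<close> let \<open>K\<^sub>P\<close> be the kernel of the localisation map
  \<open>M \<rightarrow> M\<^sub>P\<close>, which is a submodule over the Weyl algebra. Since \<open>R\<close> is Noetherian and \<open>P\<close> is the only
  associated prime inside \<open>P\<close>, every element of the nonzero module \<open>M / K\<^sub>P\<close> is killed by a power of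
  each \<open>f \<in> P\<close>.

  By the Nullstellensatz each \<open>X\<^sub>i\<close> is algebraic modulo \<open>P\<close> over \<open>K[X\<^sub>1, \<dots>, X\<^sub>i\<^sub>-\<^sub>1]\<close>, so in
  characteristic 0 there is \<open>g \<in> P \<inter> K[X\<^sub>1, \<dots>, X\<^sub>i]\<close> with \<open>\<partial>\<^sub>i g \<notin> P\<close>. Divide \<open>N = M / K\<^sub>P\<close>
  successively by the images of \<open>\<partial>\<^sub>n, \<dots>, \<partial>\<^sub>1\<close>. If \<open>v \<noteq> 0\<close>, \<open>g v = 0\<close> and \<open>v = \<partial>\<^sub>i w\<close>, then applying \<open>\<partial>\<^sub>i\<close>
  to \<open>g\<^sup>k w = 0\<close> gives \<open>k (\<partial>\<^sub>i g) g\<^sup>k\<^sup>-\<^sup>1 w = 0\<close>, hence \<open>g\<^sup>k\<^sup>-\<^sup>1 w = 0\<close>, and descending to \<open>k = 0\<close> yields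
  \<open>w = 0\<close>. So no quotient in the chain vanishes, and \<open>K\<^sub>P + \<Sum> \<partial>\<^sub>i M\<close> is a proper subspace.

  By the Chinese remainder theorem there are vectors \<open>v\<^sub>P\<close> outside \<open>K\<^sub>P + \<Sum> \<partial>\<^sub>i M\<close> that lie in
  \<open>K\<^sub>Q\<close> for all other isolated maximal \<open>Q\<close>; these are linearly independent modulo \<open>\<Sum> \<partial>\<^sub>i M\<close>.\<close>

section \<open>Adjoining an element to a subring\<close>

text \<open>Rings are subsets of one ambient type so that an induction on the variables can run
  through nested subrings of R.\<close>

locale subring_of =
  fixes A :: "'a::comm_ring_1 set"
  assumes one: "1 \<in> A"
    and diff: "a \<in> A \<Longrightarrow> b \<in> A \<Longrightarrow> a - b \<in> A"
    and mult: "a \<in> A \<Longrightarrow> b \<in> A \<Longrightarrow> a * b \<in> A"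
begin

lemma zero: "0 \<in> A"
  using diff[OF one one] by simp

lemma uminus: "a \<in> A \<Longrightarrow> - a \<in> A"
  using diff[OF zero] by simp

lemma add: "a \<in> A \<Longrightarrow> b \<in> A \<Longrightarrow> a + b \<in> A"
  using diff[of a "- b"] uminus[of b] by simp

lemma sum: "(\<And>i. i \<in> I \<Longrightarrow> f i \<in> A) \<Longrightarrow> sum f I \<in> A"
  by (induction I rule: infinite_finite_induct) (auto intro: zero add)

lemma power: "a \<in> A \<Longrightarrow> a ^ n \<in> A"
  by (induction n) (auto intro: one mult)

lemma of_nat: "of_nat n \<in> A"
  by (induction n) (auto intro: zero one add)

end

definition polys_over :: "'a::comm_ring_1 set \<Rightarrow> 'a poly set" where
  "polys_over A = {q. \<forall>j. coeff q j \<in> A}"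

definition adjoin :: "'a::comm_ring_1 set \<Rightarrow> 'a \<Rightarrow> 'a set" where
  "adjoin A X = (\<lambda>q. poly q X) ` polys_over A"

text \<open>Degree less than \<open>N\<close>, with \<open>below 0\<close> singling out the zero
  polynomial, which \<open>degree\<close> does not separate from the constants.\<close>

definition below :: "nat \<Rightarrow> 'a::zero poly \<Rightarrow> bool" where
  "below N q \<longleftrightarrow> (\<forall>j\<ge>N. coeff q j = 0)"

lemma below_0: "below 0 q \<longleftrightarrow> q = 0"
  by (auto simp: below_def poly_eq_iff)

lemma below_mono: "below M q \<Longrightarrow> M \<le> N \<Longrightarrow> below N q"
  by (auto simp: below_def)

lemma below_Suc_degree: "below (Suc (degree q)) q"
  by (auto simp: below_def intro: coeff_eq_0)

lemma below_zero [simp]: "below N 0"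
  by (simp add: below_def)

lemma below_add: "below N p \<Longrightarrow> below N q \<Longrightarrow> below N (p + q)"
  by (simp add: below_def)

lemma below_diff:
  fixes p q :: "'a::ab_group_add poly"
  shows "below N p \<Longrightarrow> below N q \<Longrightarrow> below N (p - q)"
  by (simp add: below_def)

lemma below_smult: "below N q \<Longrightarrow> below N (smult a q)"
  by (simp add: below_def)

lemma below_1_eq: "below (Suc 0) q \<Longrightarrow> q = [:coeff q 0:]"
  by (auto simp: below_def poly_eq_iff coeff_pCons split: nat.split)

lemma coeff_monom_times_shift:
  fixes q :: "'a::comm_semiring_1 poly"
  assumes "e \<le> N"
  shows "coeff (monom a (N - e) * q) N = a * coeff q e"
  using assms by (simp add: coeff_monom_mult)

lemma below_monom_times:
  fixes q :: "'a::comm_semiring_1 poly"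
  assumes "below (Suc e) q" "e \<le> N"
  shows "below (Suc N) (monom a (N - e) * q)"
  using assms by (auto simp: below_def coeff_monom_mult)

context subring_of
begin

lemma polys_over_subring: "subring_of (polys_over A)"
proof
  show "1 \<in> polys_over A"
    by (auto simp: polys_over_def coeff_1 intro: zero one)
next
  fix p q assume "p \<in> polys_over A" "q \<in> polys_over A"
  then show "p - q \<in> polys_over A" and "p * q \<in> polys_over A"
    by (auto simp: polys_over_def coeff_mult intro: diff mult sum)
qed

lemma adjoin_subring: "subring_of (adjoin A X)"
proof -
  interpret Q: subring_of "polys_over A" by (rule polys_over_subring)
  show ?thesis
  proof
    show "1 \<in> adjoin A X"
      using Q.one by (force simp: adjoin_def)
  next
    fix a b assume "a \<in> adjoin A X" "b \<in> adjoin A X"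
    then obtain p q where "p \<in> polys_over A" "q \<in> polys_over A" "a = poly p X" "b = poly q X"
      by (auto simp: adjoin_def)
    then have "a - b = poly (p - q) X" "a * b = poly (p * q) X" "p - q \<in> polys_over A" "p * q \<in> polys_over A"
      by (auto intro: Q.diff Q.mult)
    then show "a - b \<in> adjoin A X" "a * b \<in> adjoin A X"
      unfolding adjoin_def by blast+
  qed
qed

lemma monom_polys_over: "a \<in> A \<Longrightarrow> monom a n \<in> polys_over A"
  by (auto simp: polys_over_def intro: zero)

lemma const_polys_over: "a \<in> A \<Longrightarrow> [:a:] \<in> polys_over A"
  using monom_polys_over[of a 0] by (simp add: monom_0)

lemma smult_polys_over: "a \<in> A \<Longrightarrow> q \<in> polys_over A \<Longrightarrow> smult a q \<in> polys_over A"
  by (auto simp: polys_over_def intro: mult)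

lemma adjoin_superset: "A \<subseteq> adjoin A X"
proof
  fix a assume "a \<in> A"
  then show "a \<in> adjoin A X"
    unfolding adjoin_def using const_polys_over by (intro image_eqI[where x = "[:a:]"]) auto
qed

lemma adjoin_least:
  assumes "subring_of S" "A \<subseteq> S" "X \<in> S"
  shows "adjoin A X \<subseteq> S"
proof
  interpret S: subring_of S by fact
  fix a assume "a \<in> adjoin A X"
  then obtain q where "q \<in> polys_over A" "a = (\<Sum>j\<le>degree q. coeff q j * X ^ j)"
    by (auto simp: adjoin_def poly_altdef)
  then show "a \<in> S"
    using assms by (auto simp: polys_over_def intro!: S.sum S.mult S.power)
qed

lemma adjoin_gen: "X \<in> adjoin A X"
  unfolding adjoin_def
  by (intro image_eqI[where x = "monom 1 1"]) (auto simp: poly_monom intro: monom_polys_over one)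

end

section \<open>Hilbert's basis theorem\<close>

definition ideal_of :: "'a::comm_ring_1 set \<Rightarrow> 'a set \<Rightarrow> bool" where
  "ideal_of A I \<longleftrightarrow> I \<subseteq> A \<and> 0 \<in> I \<and> (\<forall>a\<in>I. \<forall>b\<in>I. a + b \<in> I) \<and> (\<forall>a\<in>A. \<forall>b\<in>I. a * b \<in> I)"

text \<open>Linear combinations built one term at a time, so that proofs go by induction without
  coefficient families.\<close>

inductive_set lin_span :: "'a::comm_ring_1 set \<Rightarrow> 'a set \<Rightarrow> 'a set" for A F where
  zero: "0 \<in> lin_span A F"
| step: "a \<in> A \<Longrightarrow> f \<in> F \<Longrightarrow> y \<in> lin_span A F \<Longrightarrow> a * f + y \<in> lin_span A F"

lemma lin_span_add: "x \<in> lin_span A F \<Longrightarrow> y \<in> lin_span A F \<Longrightarrow> x + y \<in> lin_span A F"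
  by (induction rule: lin_span.induct) (auto simp: add.assoc intro: lin_span.step)

lemma lin_span_ideal: "ideal_of A I \<Longrightarrow> F \<subseteq> I \<Longrightarrow> lin_span A F \<subseteq> I"
proof
  fix x assume I: "ideal_of A I" "F \<subseteq> I" and "x \<in> lin_span A F"
  from this(3) show "x \<in> I"
    by (induction rule: lin_span.induct) (use I in \<open>auto simp: ideal_of_def\<close>)
qed

definition noetherian_set :: "'a::comm_ring_1 set \<Rightarrow> bool" where
  "noetherian_set A \<longleftrightarrow> (\<forall>I. ideal_of A I \<longrightarrow> (\<exists>F. finite F \<and> F \<subseteq> I \<and> I \<subseteq> lin_span A F))"

text \<open>Hilbert's argument: the leading coefficients in each degree form an increasing chain of
  ideals of \<open>A\<close>, and generators in finitely many degrees control all of them.\<close>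

lemma (in subring_of) noetherian_polys_over:
  assumes "noetherian_set A"
  shows "noetherian_set (polys_over A)"
  unfolding noetherian_set_def
proof (intro allI impI)
  fix J assume J: "ideal_of (polys_over A) J"
  interpret Q: subring_of "polys_over A" by (rule polys_over_subring)
  have J_add: "p + q \<in> J" if "p \<in> J" "q \<in> J" for p q
    using J that by (auto simp: ideal_of_def)
  have J_mult: "p * q \<in> J" if "p \<in> polys_over A" "q \<in> J" for p q
    using J that by (auto simp: ideal_of_def)
  have J_0: "0 \<in> J" and J_sub: "J \<subseteq> polys_over A"
    using J by (auto simp: ideal_of_def)
  have J_diff: "p - q \<in> J" if "p \<in> J" "q \<in> J" for p q
    using J_add[OF that(1) J_mult[OF Q.uminus[OF Q.one] that(2)]] by simp
  \<comment> \<open>Allowing a zero coefficient at \<open>e\<close> makes \<open>L e\<close> an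
    ideal without case distinctions on the degree.\<close>
  define L where "L e = {coeff q e | q. q \<in> J \<and> below (Suc e) q}" for e
  have L_memI: "coeff q e \<in> L e" if "q \<in> J" "below (Suc e) q" for q e
    using that by (auto simp: L_def)
  have L_ideal: "ideal_of A (L e)" for e
    unfolding ideal_of_def
  proof (intro conjI ballI)
    show "L e \<subseteq> A"
      using J_sub by (auto simp: L_def polys_over_def)
    show "0 \<in> L e"
      using L_memI[OF J_0, of e] by simp
  next
    fix a b assume "a \<in> L e" "b \<in> L e"
    then obtain p q where "p \<in> J" "below (Suc e) p" "a = coeff p e" "q \<in> J" "below (Suc e) q" "b = coeff q e"
      by (auto simp: L_def)
    then show "a + b \<in> L e"
      using L_memI[of "p + q" e] J_add below_add[of "Suc e" p q] by auto
  next
    fix a b assume "a \<in> A" "b \<in> L e"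
    then obtain q where "q \<in> J" "below (Suc e) q" "b = coeff q e"
      by (auto simp: L_def)
    then show "a * b \<in> L e"
      using L_memI[of "[:a:] * q" e] J_mult[OF const_polys_over[OF \<open>a \<in> A\<close>]] below_smult[of "Suc e" q a]
      by auto
  qed
  have L_mono: "L d \<subseteq> L e" if "d \<le> e" for d e
  proof
    fix a assume "a \<in> L d"
    then obtain q where q: "q \<in> J" "below (Suc d) q" "a = coeff q d"
      by (auto simp: L_def)
    then show "a \<in> L e"
      using L_memI[of "monom 1 (e - d) * q" e] J_mult[OF monom_polys_over[OF one]]
        below_monom_times[OF q(2) that] coeff_monom_times_shift[OF that, of 1 q] by auto
  qed
  \<comment> \<open>The union is finitely generated and its generators lie in a single
    \<open>L D\<close>; this replaces stabilisation of the chain.\<close>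
  have "ideal_of A (\<Union>e. L e)"
    unfolding ideal_of_def
  proof (intro conjI ballI)
    show "(\<Union>e. L e) \<subseteq> A" "0 \<in> (\<Union>e. L e)"
      using L_ideal unfolding ideal_of_def by blast+
  next
    fix a b assume "a \<in> (\<Union>e. L e)" "b \<in> (\<Union>e. L e)"
    then obtain d e where "a \<in> L d" "b \<in> L e" by auto
    then have "a \<in> L (max d e)" "b \<in> L (max d e)"
      using L_mono[of d "max d e"] L_mono[of e "max d e"] by auto
    then show "a + b \<in> (\<Union>e. L e)"
      using L_ideal[of "max d e"] by (auto simp: ideal_of_def)
  next
    fix a b assume "a \<in> A" "b \<in> (\<Union>e. L e)"
    then obtain e where "b \<in> L e" by auto
    then have "a * b \<in> L e" using L_ideal[of e] \<open>a \<in> A\<close> by (simp add: ideal_of_def)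
    then show "a * b \<in> (\<Union>e. L e)" by auto
  qed
  then obtain F where F: "finite F" "F \<subseteq> (\<Union>e. L e)" "(\<Union>e. L e) \<subseteq> lin_span A F"
    using assms unfolding noetherian_set_def by blast
  have "\<exists>D. F \<subseteq> L D"
    using F(1,2)
  proof (induction F)
    case (insert f F)
    then obtain D e where De: "F \<subseteq> L D" "f \<in> L e" by auto
    then have "insert f F \<subseteq> L (max D e)"
      using L_mono[of D "max D e"] L_mono[of e "max D e"] by auto
    then show ?case by blast
  qed auto
  then obtain D where D: "F \<subseteq> L D" by blast
  have "\<forall>e. \<exists>G. finite G \<and> G \<subseteq> L e \<and> L e \<subseteq> lin_span A G"
    using assms L_ideal unfolding noetherian_set_def by blast
  then obtain G where G: "\<And>e. finite (G e)" "\<And>e. G e \<subseteq> L e" "\<And>e. L e \<subseteq> lin_span A (G e)"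
    by metis
  \<comment> \<open>\<open>F\<close> lies in \<open>L D\<close> and generates the whole union, so it
    serves every degree from \<open>D\<close> on; each smaller degree keeps its own
    generators.\<close>
  define H where "H e = (if e < D then G e else F)" for e
  define lift where "lift e c = (SOME q. q \<in> J \<and> below (Suc e) q \<and> coeff q e = c)" for e c
  have lift: "lift e c \<in> J \<and> below (Suc e) (lift e c) \<and> coeff (lift e c) e = c" if "c \<in> L e" for e c
    unfolding lift_def by (rule someI_ex) (use that in \<open>auto simp: L_def\<close>)
  define S where "S = (\<Union>e\<le>D. lift e ` H e)"
  have H_sub: "H e \<subseteq> L e" if "e \<le> D" for e
    using that G(2)[of e] D by (auto simp: H_def)
  have H_span: "L N \<subseteq> lin_span A (H (min N D))" for N
    using G(3)[of N] F(3) by (auto simp: H_def min_def)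
  have S_J: "S \<subseteq> J"
    using H_sub lift by (fastforce simp: S_def)
  \<comment> \<open>A polynomial lifted in degree \<open>min N D\<close> is shifted to degree
    \<open>N\<close> by a monomial.\<close>
  have top: "\<exists>h\<in>lin_span (polys_over A) S. below (Suc N) h \<and> coeff h N = c"
    if "c \<in> lin_span A (H (min N D))" for c N
    using that
  proof (induction rule: lin_span.induct)
    case zero
    then show ?case by (intro bexI[of _ 0]) (auto intro: lin_span.zero)
  next
    case (step a f y)
    then obtain h where h: "h \<in> lin_span (polys_over A) S" "below (Suc N) h" "coeff h N = y"
      by blast
    define e where "e = min N D"
    have e: "e \<le> N" "e \<le> D" by (auto simp: e_def)
    have f: "f \<in> L e" using step H_sub[OF e(2)] by (auto simp: e_def)
    have "lift e f \<in> S" using step e by (auto simp: S_def e_def)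
    then have "monom a (N - e) * lift e f + h \<in> lin_span (polys_over A) S"
      by (intro lin_span.step monom_polys_over step h)
    moreover have "below (Suc N) (monom a (N - e) * lift e f + h)"
      using below_monom_times[OF _ e(1)] lift[OF f] h below_add by blast
    moreover have "coeff (monom a (N - e) * lift e f + h) N = a * f + y"
      using coeff_monom_times_shift[OF e(1), of a "lift e f"] lift[OF f] h by simp
    ultimately show ?case by blast
  qed
  \<comment> \<open>Subtracting an element of the span with the same coefficient at \<open>N\<close>
    lowers the degree bound.\<close>
  have "q \<in> lin_span (polys_over A) S" if "q \<in> J" "below N q" for q N
    using that
  proof (induction N arbitrary: q)
    case 0
    then show ?case by (simp add: below_0 lin_span.zero)
  next
    case (Suc N)
    then have "coeff q N \<in> L N" by (intro L_memI)
    then obtain h where h: "h \<in> lin_span (polys_over A) S" "below (Suc N) h" "coeff h N = coeff q N"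
      using top H_span by blast
    have "h \<in> J" using h(1) lin_span_ideal[OF J S_J] by blast
    moreover have "below N (q - h)"
      using Suc.prems(2) h(2,3) by (simp add: below_def nat_less_le Suc_le_eq) metis
    ultimately have "q - h \<in> lin_span (polys_over A) S"
      using Suc J_diff by blast
    from lin_span_add[OF this h(1)] show ?case by simp
  qed
  then have "J \<subseteq> lin_span (polys_over A) S"
    using below_Suc_degree by blast
  moreover have "finite S"
    unfolding S_def using G(1) F(1) by (auto simp: H_def)
  ultimately show "\<exists>S. finite S \<and> S \<subseteq> J \<and> J \<subseteq> lin_span (polys_over A) S"
    using S_J by blast
qed

text \<open>The ideal is pulled back along evaluation at \<open>X\<close>, and generators of the
  preimage evaluate to generators.\<close>

theorem (in subring_of) noetherian_adjoin:
  assumes "noetherian_set A"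
  shows "noetherian_set (adjoin A X)"
  unfolding noetherian_set_def
proof (intro allI impI)
  fix I assume I: "ideal_of (adjoin A X) I"
  interpret Q: subring_of "polys_over A" by (rule polys_over_subring)
  define J where "J = {q \<in> polys_over A. poly q X \<in> I}"
  have "ideal_of (polys_over A) J"
    using I Q.zero Q.add Q.mult by (auto simp: ideal_of_def J_def adjoin_def)
  then obtain F where F: "finite F" "F \<subseteq> J" "J \<subseteq> lin_span (polys_over A) F"
    using noetherian_polys_over[OF assms] unfolding noetherian_set_def by blast
  have eval: "poly q X \<in> lin_span (adjoin A X) ((\<lambda>q. poly q X) ` F)"
    if "q \<in> lin_span (polys_over A) F" for q
    using that
    by (induction rule: lin_span.induct) (auto simp: adjoin_def intro: lin_span.zero lin_span.step)
  have "I \<subseteq> lin_span (adjoin A X) ((\<lambda>q. poly q X) ` F)"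
  proof
    fix a assume "a \<in> I"
    then obtain q where "q \<in> polys_over A" "a = poly q X"
      using I by (auto simp: ideal_of_def adjoin_def)
    then show "a \<in> lin_span (adjoin A X) ((\<lambda>q. poly q X) ` F)"
      using \<open>a \<in> I\<close> eval F(3) by (auto simp: J_def)
  qed
  moreover have "(\<lambda>q. poly q X) ` F \<subseteq> I"
    using F(2) by (auto simp: J_def)
  ultimately show "\<exists>F. finite F \<and> F \<subseteq> I \<and> I \<subseteq> lin_span (adjoin A X) F"
    using F(1) by blast
qed

lemma noetherian_field:
  assumes "\<And>c. c \<in> A \<Longrightarrow> c \<noteq> 0 \<Longrightarrow> \<exists>c'\<in>A. c * c' = 1"
  shows "noetherian_set A"
  unfolding noetherian_set_def
proof (intro allI impI)
  fix I assume I: "ideal_of A I"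
  show "\<exists>F. finite F \<and> F \<subseteq> I \<and> I \<subseteq> lin_span A F"
  proof (cases "I = {0}")
    case True
    then show ?thesis by (intro exI[of _ "{}"]) (auto intro: lin_span.zero)
  next
    case False
    then obtain c where c: "c \<in> I" "c \<noteq> 0" using I by (auto simp: ideal_of_def)
    then have "c \<in> A" using I by (auto simp: ideal_of_def)
    then obtain c' where "c' \<in> A" "c * c' = 1" using assms c(2) by blast
    moreover from this have "c' * c \<in> I" using c I by (simp add: ideal_of_def)
    ultimately have "1 \<in> I" by (simp add: mult.commute)
    moreover have "I \<subseteq> lin_span A {1}"
    proof
      fix a assume "a \<in> I"
      then have "a \<in> A" using I by (auto simp: ideal_of_def)
      from lin_span.step[OF this singletonI[of 1] lin_span.zero] show "a \<in> lin_span A {1}" by simp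
    qed
    ultimately show ?thesis by (intro exI[of _ "{1}"]) auto
  qed
qed

text \<open>Zorn's lemma applies: the union of a nonempty chain has finitely many generators, which
  already lie in one member, so the union is that member.\<close>

lemma noetherian_maximal_element:
  fixes \<F> :: "'a::comm_ring_1 set set"
  assumes noeth: "noetherian_set (UNIV :: 'a set)"
    and ideals: "\<And>I. I \<in> \<F> \<Longrightarrow> is_ideal I" and "\<F> \<noteq> {}"
  shows "\<exists>I\<in>\<F>. \<forall>J\<in>\<F>. I \<subseteq> J \<longrightarrow> J = I"
proof -
  have chain_Union: "\<Union>\<C> \<in> \<F>" if ne: "\<C> \<noteq> {}" and ch: "subset.chain \<F> \<C>" for \<C>
  proof -
    have sub: "\<C> \<subseteq> \<F>" using ch by (auto simp: subset.chain_def)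
    have "ideal_of UNIV (\<Union>\<C>)"
      unfolding ideal_of_def
    proof (intro conjI ballI)
      show "0 \<in> \<Union>\<C>" using ne sub ideals by (fastforce simp: is_ideal_def)
    next
      fix a b assume "a \<in> \<Union>\<C>" "b \<in> \<Union>\<C>"
      then obtain I J where IJ: "I \<in> \<C>" "a \<in> I" "J \<in> \<C>" "b \<in> J" by auto
      then have "I \<subseteq> J \<or> J \<subseteq> I" using ch by (auto simp: subset.chain_def)
      then show "a + b \<in> \<Union>\<C>"
        using IJ sub ideals unfolding is_ideal_def by (meson UnionI subsetD)
    next
      fix a b assume "b \<in> \<Union>\<C>"
      then show "a * b \<in> \<Union>\<C>" using sub ideals by (fastforce simp: is_ideal_def)
    qed simp
    then obtain F where F: "finite F" "F \<subseteq> \<Union>\<C>" "\<Union>\<C> \<subseteq> lin_span UNIV F"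
      using noeth unfolding noetherian_set_def by blast
    obtain I where I: "I \<in> \<C>" "F \<subseteq> I"
      using finite_subset_Union_chain[OF F(1,2) ne ch] by blast
    then have "ideal_of UNIV I" using sub ideals[of I] by (auto simp: is_ideal_def ideal_of_def)
    then have "\<Union>\<C> \<subseteq> I" using F(3) lin_span_ideal[OF _ I(2)] by blast
    then have "\<Union>\<C> = I" using I by auto
    then show ?thesis using I sub by auto
  qed
  show ?thesis
    using subset_Zorn_nonempty[OF \<open>\<F> \<noteq> {}\<close> chain_Union] .
qed

section \<open>The Nullstellensatz\<close>

locale ring_prime =
  fixes P :: "'a::comm_ring_1 set"
  assumes prime: "prime_ideal P"
begin

lemma P_0: "0 \<in> P" and P_add: "a \<in> P \<Longrightarrow> b \<in> P \<Longrightarrow> a + b \<in> P"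
  and P_mult: "a \<in> P \<Longrightarrow> r * a \<in> P" and P_1: "1 \<notin> P"
  and P_prime: "a * b \<in> P \<Longrightarrow> a \<in> P \<or> b \<in> P"
  using prime by (auto simp: prime_ideal_def is_ideal_def)

lemma P_mult': "a \<in> P \<Longrightarrow> a * r \<in> P"
  using P_mult[of a r] by (simp add: mult.commute)

lemma P_uminus: "a \<in> P \<Longrightarrow> - a \<in> P"
  using P_mult[of a "- 1"] by simp

lemma P_diff: "a \<in> P \<Longrightarrow> b \<in> P \<Longrightarrow> a - b \<in> P"
  using P_add[of a "- b"] P_uminus[of b] by simp

lemma P_sum: "(\<And>i. i \<in> I \<Longrightarrow> f i \<in> P) \<Longrightarrow> sum f I \<in> P"
  by (induction I rule: infinite_finite_induct) (auto intro: P_0 P_add)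

lemma not_P_mult: "a \<notin> P \<Longrightarrow> b \<notin> P \<Longrightarrow> a * b \<notin> P"
  using P_prime by blast

lemma not_P_power: "a \<notin> P \<Longrightarrow> a ^ n \<notin> P"
  by (induction n) (use P_1 not_P_mult in auto)

text \<open>This stands for equality in R / P, so that the quotient ring need not be formed.\<close>

definition eqv :: "'a \<Rightarrow> 'a \<Rightarrow> bool" (infix \<open>\<approx>\<close> 50) where
  "a \<approx> b \<longleftrightarrow> a - b \<in> P"

lemma eqv_refl [simp]: "a \<approx> a"
  by (simp add: eqv_def P_0)

lemma eqv_sym: "a \<approx> b \<Longrightarrow> b \<approx> a"
  using P_uminus[of "a - b"] by (simp add: eqv_def)

lemma eqv_trans [trans]: "a \<approx> b \<Longrightarrow> b \<approx> c \<Longrightarrow> a \<approx> c"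
  using P_add[of "a - b" "b - c"] by (simp add: eqv_def)

lemma eqv_mult: "a \<approx> b \<Longrightarrow> c \<approx> e \<Longrightarrow> a * c \<approx> b * e"
proof -
  assume "a \<approx> b" "c \<approx> e"
  moreover have "a * c - b * e = (a - b) * c + b * (c - e)" by (simp add: algebra_simps)
  ultimately show ?thesis unfolding eqv_def by (simp add: P_add P_mult P_mult')
qed

lemma eqv_power: "a \<approx> b \<Longrightarrow> a ^ n \<approx> b ^ n"
  by (induction n) (auto intro: eqv_mult)

lemma eqv_P: "a \<approx> b \<Longrightarrow> a \<in> P \<longleftrightarrow> b \<in> P"
  using P_add[of "a - b" b] P_diff[of a "a - b"] by (auto simp: eqv_def)

text \<open>Degrees add over the domain R / P: in every other product contributing at
  \<open>a + b\<close>, one index exceeds its bound, so that factor lies in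
  \<open>P\<close>.\<close>

lemma coeff_mult_top_not_P:
  assumes p: "coeff p a \<notin> P" "\<And>j. j > a \<Longrightarrow> coeff p j \<in> P"
    and q: "coeff q b \<notin> P" "\<And>j. j > b \<Longrightarrow> coeff q j \<in> P"
  shows "coeff (p * q) (a + b) \<notin> P"
proof -
  have "coeff (p * q) (a + b) = coeff p a * coeff q b
      + (\<Sum>i\<in>{..a + b} - {a}. coeff p i * coeff q (a + b - i))"
    by (simp add: coeff_mult sum.remove[of "{..a + b}" a])
  moreover have "(\<Sum>i\<in>{..a + b} - {a}. coeff p i * coeff q (a + b - i)) \<in> P"
  proof (rule P_sum)
    fix i assume "i \<in> {..a + b} - {a}"
    then have "i > a \<or> a + b - i > b" by auto
    then show "coeff p i * coeff q (a + b - i) \<in> P"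
      using p(2) q(2) P_mult P_mult' by blast
  qed
  ultimately show ?thesis
    using P_diff[of "coeff (p * q) (a + b)" "\<Sum>i\<in>{..a + b} - {a}. coeff p i * coeff q (a + b - i)"]
      not_P_mult[OF p(1) q(1)] by auto
qed

lemma top_coeff_not_P:
  assumes "coeff q i \<notin> P"
  obtains b where "b \<ge> i" "coeff q b \<notin> P" "\<And>j. j > b \<Longrightarrow> coeff q j \<in> P"
proof -
  have fin: "{j. coeff q j \<notin> P} \<subseteq> {..degree q}"
    using P_0 by (auto intro!: le_degree)
  then have "finite {j. coeff q j \<notin> P}" by (rule finite_subset) simp
  then show thesis
    using that[of "Max {j. coeff q j \<notin> P}"] Max_in[of "{j. coeff q j \<notin> P}"] Max_ge[of "{j. coeff q j \<notin> P}"] assms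
    by (metis (mono_tags, lifting) empty_iff leD mem_Collect_eq)
qed

text \<open>Says that \<open>A / (P \<inter> A)\<close> becomes a field after inverting a single element.\<close>
definition G_domain :: "'a set \<Rightarrow> bool" where
  "G_domain A \<longleftrightarrow> (\<exists>s\<in>A - P. \<forall>c\<in>A - P. \<exists>k. \<exists>u\<in>A. u * c \<approx> s ^ k)"

text \<open>Modulo \<open>P\<close>, \<open>f\<close> is a minimal polynomial of \<open>X\<close>
  over the fraction field of the image of \<open>A\<close>, with denominators cleared; hence it need
  not be monic.\<close>

definition minpoly :: "'a set \<Rightarrow> 'a \<Rightarrow> nat \<Rightarrow> 'a poly \<Rightarrow> bool" where
  "minpoly A X m f \<longleftrightarrow> f \<in> polys_over A \<and> poly f X \<in> P \<and> below (Suc m) f \<and> coeff f m \<notin> P \<and>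
     (\<forall>g\<in>polys_over A. below m g \<and> poly g X \<in> P \<longrightarrow> (\<forall>j. coeff g j \<in> P))"

end

section \<open>Polynomials over a subring modulo the prime\<close>

locale ring_prime_subring = ring_prime P + subring_of A for P A :: "'a::comm_ring_1 set"
begin

sublocale Q: subring_of "polys_over A"
  by (rule polys_over_subring)

text \<open>Leading terms with coefficient in \<open>P\<close> do not change the value modulo
  \<open>P\<close>, and dropping them must stop because the value is not in
  \<open>P\<close>.\<close>

lemma trim:
  assumes "h \<in> polys_over A" "below m h" "poly h X \<notin> P"
  obtains h' e where "h' \<in> polys_over A" "e < m" "below (Suc e) h'" "coeff h' e \<notin> P" "poly h' X \<approx> poly h X"
  using assms
proof (induction m arbitrary: h thesis)
  case 0
  then show ?case by (simp add: below_0 P_0)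
next
  case (Suc m)
  show ?case
  proof (cases "coeff h m \<in> P")
    case False
    then show ?thesis using Suc.prems by (intro Suc.prems(1)[of h m]) auto
  next
    case True
    define g where "g = h - monom (coeff h m) m"
    have "coeff h m \<in> A" using Suc.prems(2) by (auto simp: polys_over_def)
    then have g: "g \<in> polys_over A"
      unfolding g_def by (intro Q.diff Suc.prems monom_polys_over)
    have gm: "below m g"
      using Suc.prems(3) by (auto simp: below_def g_def)
    have "poly g X \<approx> poly h X"
      using P_uminus[OF P_mult'[OF True]] by (simp add: eqv_def g_def poly_monom)
    moreover from this have "poly g X \<notin> P" using Suc.prems(4) eqv_P by blast
    ultimately show ?thesis
      using Suc.IH[OF _ g gm] Suc.prems(1) less_SucI eqv_trans by metis
  qed
qed

text \<open>Removing a top term with coefficient in \<open>P\<close> keeps the value in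
  \<open>P\<close>, so control of top coefficients alone reaches all coefficients one by
  one.\<close>

lemma coeffs_in_P:
  assumes "\<And>N g. N < m \<Longrightarrow> g \<in> polys_over A \<Longrightarrow> poly g X \<in> P \<Longrightarrow> below (Suc N) g \<Longrightarrow> coeff g N \<in> P"
    and "g \<in> polys_over A" "poly g X \<in> P" "below m g"
  shows "coeff g j \<in> P"
  using assms
proof (induction m arbitrary: g j)
  case 0
  then show ?case by (simp add: below_0 P_0)
next
  case (Suc N)
  have cP: "coeff g N \<in> P" using Suc.prems by blast
  have "coeff g N \<in> A" using Suc.prems by (auto simp: polys_over_def)
  then have "g - monom (coeff g N) N \<in> polys_over A"
    using Suc.prems by (intro Q.diff monom_polys_over)
  moreover have "below N (g - monom (coeff g N) N)"
    using Suc.prems(4) by (auto simp: below_def)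
  moreover have "poly (g - monom (coeff g N) N) X \<in> P"
    using Suc.prems(3) P_mult'[OF cP] by (simp add: poly_monom P_diff)
  ultimately have "coeff (g - monom (coeff g N) N) j \<in> P"
    using Suc.IH Suc.prems(1) by (meson less_SucI)
  then show ?case using cP by (cases "j = N") auto
qed

text \<open>The leading coefficient of the divisor is not assumed invertible, hence the factor
  \<open>coeff f m ^ k\<close>. The bound on \<open>q\<close> later allows the minimality in
  \<open>minpoly\<close> to be applied to a quotient.\<close>

lemma pseudo_division:
  assumes f: "f \<in> polys_over A" "below (Suc m) f"
    and "h \<in> polys_over A" "below N h"
  shows "\<exists>k q r. q \<in> polys_over A \<and> r \<in> polys_over A \<and> below m r \<and> below (N - m) q \<and>
           smult (coeff f m ^ k) h = q * f + r"
  using assms(3,4)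
proof (induction N arbitrary: h)
  case 0
  then show ?case
    by (intro exI[of _ 0] exI[of _ h]) (auto simp: Q.zero below_0)
next
  case (Suc N)
  show ?case
  proof (cases "Suc N \<le> m")
    case True
    then show ?thesis
      using Suc.prems below_mono by (intro exI[of _ 0] exI[of _ h]) (auto simp: Q.zero)
  next
    case False
    then have mN: "m \<le> N" by simp
    define a where "a = coeff f m"
    define t where "t = monom (coeff h N) (N - m)"
    have aA: "a \<in> A" using f by (auto simp: polys_over_def a_def)
    have hA: "coeff h N \<in> A" using Suc.prems by (auto simp: polys_over_def)
    have t: "t \<in> polys_over A" unfolding t_def by (intro monom_polys_over hA)
    define g where "g = smult a h - t * f"
    have g: "g \<in> polys_over A"
      unfolding g_def using aA t f Suc.prems by (intro Q.diff Q.mult smult_polys_over)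
    have "below (Suc N) g"
      unfolding g_def t_def using below_monom_times[OF f(2) mN] Suc.prems(2)
      by (intro below_diff below_smult)
    moreover have "coeff g N = 0"
      using coeff_monom_times_shift[OF mN, of "coeff h N" f] by (simp add: g_def t_def a_def mult.commute)
    ultimately have gN: "below N g"
      by (auto simp: below_def) (metis le_antisym not_less_eq_eq)
    obtain k q r where qr: "q \<in> polys_over A" "r \<in> polys_over A" "below m r" "below (N - m) q"
      "smult (a ^ k) g = q * f + r"
      using Suc.IH[OF g gN] unfolding a_def by blast
    have "smult (a ^ Suc k) h = smult (a ^ k) (g + t * f)"
      by (simp add: g_def mult.commute)
    also have "\<dots> = (q + smult (a ^ k) t) * f + r"
      using qr(5) by (simp add: smult_add_right algebra_simps)
    finally have "smult (a ^ Suc k) h = (q + smult (a ^ k) t) * f + r" .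
    moreover have "q + smult (a ^ k) t \<in> polys_over A"
      using qr t aA by (intro Q.add smult_polys_over power)
    moreover have "below (Suc N - m) (q + smult (a ^ k) t)"
      using qr(4) mN by (auto simp: below_def t_def)
    ultimately show ?thesis using qr unfolding a_def by blast
  qed
qed

lemma minpoly_pos:
  assumes "minpoly A X m f"
  shows "m > 0"
proof (rule ccontr)
  assume "\<not> m > 0"
  then have "poly f X = coeff f m"
    using assms below_1_eq[of f] by (auto simp: minpoly_def) (metis poly_0 poly_pCons mult_zero_right add.right_neutral)
  then show False using assms by (auto simp: minpoly_def)
qed

text \<open>If \<open>X\<close> were transcendental modulo \<open>P\<close>, then with
  \<open>s = poly \<sigma> X\<close> the element \<open>1 - X * s\<close> would divide a power of
  \<open>s\<close>, hence 1, and so be a unit of positive degree in a polynomial ring over a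
  domain.\<close>

lemma minpoly_exists:
  assumes G: "G_domain (adjoin A X)"
  obtains m f where "minpoly A X m f"
proof -
  define E where "E m \<longleftrightarrow> (\<exists>f\<in>polys_over A. poly f X \<in> P \<and> below (Suc m) f \<and> coeff f m \<notin> P)" for m
  have "\<exists>m. E m"
  proof (rule ccontr)
    assume no: "\<nexists>m. E m"
    have coeffs: "coeff g j \<in> P" if "g \<in> polys_over A" "poly g X \<in> P" for g j
      using coeffs_in_P[OF _ that below_Suc_degree] no unfolding E_def by blast
    obtain s where s: "s \<in> adjoin A X - P"
      and inv: "\<And>c. c \<in> adjoin A X - P \<Longrightarrow> \<exists>k. \<exists>u\<in>adjoin A X. u * c \<approx> s ^ k"
      using G by (auto simp: G_domain_def)
    obtain \<sigma> where \<sigma>: "\<sigma> \<in> polys_over A" "s = poly \<sigma> X"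
      using s by (auto simp: adjoin_def)
    obtain i where i: "coeff \<sigma> i \<notin> P"
    proof (rule ccontr)
      assume "\<not> thesis"
      then have "\<And>i. coeff \<sigma> i \<in> P" using that by blast
      then have "poly \<sigma> X \<in> P"
        by (auto simp: poly_altdef intro!: P_sum P_mult')
      then show False using s \<sigma> by simp
    qed
    define T where "T = (monom 1 1 :: 'a poly)"
    have T: "T \<in> polys_over A" unfolding T_def by (intro monom_polys_over one)
    define \<gamma> where "\<gamma> = 1 - T * \<sigma>"
    have \<gamma>A: "\<gamma> \<in> polys_over A"
      unfolding \<gamma>_def by (intro Q.diff Q.one Q.mult T \<sigma>)
    have \<gamma>_coeff: "coeff \<gamma> j = (case j of 0 \<Rightarrow> 1 | Suc j \<Rightarrow> - coeff \<sigma> j)" for j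
      by (auto simp: \<gamma>_def T_def coeff_monom_mult coeff_1 split: nat.split)
    have "poly \<gamma> X \<notin> P"
      using coeffs[OF \<gamma>A, of 0] P_1 by (auto simp: \<gamma>_coeff)
    then obtain k u where u: "u \<in> adjoin A X" "u * poly \<gamma> X \<approx> s ^ k"
      using inv[of "poly \<gamma> X"] \<gamma>A by (auto simp: adjoin_def)
    then obtain \<upsilon> where \<upsilon>: "\<upsilon> \<in> polys_over A" "u = poly \<upsilon> X" by (auto simp: adjoin_def)
    \<comment> \<open>Since \<open>T \<sigma> = 1 - \<gamma>\<close>, the relation \<open>u \<gamma> = \<sigma>^k\<close> turns \<open>\<gamma>\<close> into a unit.\<close>
    define y where "y = (\<Sum>j<k. (T * \<sigma>) ^ j) + T ^ k * \<upsilon>"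
    have yA: "y \<in> polys_over A"
      unfolding y_def by (intro Q.add Q.sum Q.power Q.mult T \<sigma> \<upsilon>)
    have geo: "\<gamma> * (\<Sum>j<k. (T * \<sigma>) ^ j) = 1 - (T * \<sigma>) ^ k"
      unfolding \<gamma>_def by (rule one_diff_power_eq[symmetric])
    have "\<gamma> * y - 1 = T ^ k * (\<upsilon> * \<gamma> - \<sigma> ^ k)"
      using geo by (simp add: y_def algebra_simps power_mult_distrib)
    then have "poly (\<gamma> * y - 1) X \<in> P"
      using u \<upsilon> \<sigma> by (simp add: eqv_def P_mult)
    then have unit: "coeff (\<gamma> * y - 1) j \<in> P" for j
      by (intro coeffs Q.diff Q.mult Q.one yA \<gamma>A)
    \<comment> \<open>\<open>\<sigma>\<close> is nonzero modulo \<open>P\<close>, so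
      \<open>\<gamma>\<close> has positive degree there, and degrees add in
      \<open>\<gamma> * y\<close>, which is 1 modulo \<open>P\<close>.\<close>
    have "coeff \<gamma> (Suc i) \<notin> P" using i P_uminus by (force simp: \<gamma>_coeff)
    then obtain a where a: "a \<ge> Suc i" "coeff \<gamma> a \<notin> P" "\<And>j. j > a \<Longrightarrow> coeff \<gamma> j \<in> P"
      using top_coeff_not_P by blast
    obtain j where "coeff y j \<notin> P"
    proof (rule ccontr)
      assume "\<not> thesis"
      then have "coeff (\<gamma> * y) 0 \<in> P" using that by (auto simp: coeff_mult intro: P_mult)
      then show False using P_diff[OF _ unit[of 0]] P_1 by fastforce
    qed
    then obtain b where b: "coeff y b \<notin> P" "\<And>j. j > b \<Longrightarrow> coeff y j \<in> P"
      using top_coeff_not_P by blast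
    have "coeff (\<gamma> * y) (a + b) \<notin> P"
      using coeff_mult_top_not_P a b by blast
    then show False
      using unit[of "a + b"] a(1) by (simp add: coeff_1)
  qed
  then have E: "E (LEAST m. E m)" by (rule LeastI_ex)
  define m where "m = (LEAST m. E m)"
  obtain f where f: "f \<in> polys_over A" "poly f X \<in> P" "below (Suc m) f" "coeff f m \<notin> P"
    using E unfolding E_def m_def by blast
  have "coeff g N \<in> P" if "N < m" "g \<in> polys_over A" "poly g X \<in> P" "below (Suc N) g" for g N
    using that not_less_Least[of N E] unfolding m_def E_def by blast
  then have "minpoly A X m f"
    using f coeffs_in_P[of m X] unfolding minpoly_def by blast
  then show thesis by (rule that)
qed

text \<open>Among the multiples of \<open>s\<close> outside \<open>P\<close>, take one represented
  by a polynomial \<open>h\<close> of least degree \<open>e\<close>. If \<open>e > 0\<close>,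
  pseudo-division of \<open>f\<close> by \<open>h\<close> would factor \<open>f\<close> modulo
  \<open>P\<close> into polynomials of degree below \<open>m\<close>; so \<open>h\<close> is a
  constant from \<open>A\<close>.\<close>

lemma inverse_mod_P:
  assumes f: "minpoly A X m f" and s: "s \<in> adjoin A X" "s \<notin> P"
  obtains t y where "t \<in> A" "t \<notin> P" "y \<in> adjoin A X" "s * y \<approx> t"
proof -
  interpret B: subring_of "adjoin A X" by (rule adjoin_subring)
  have fA: "f \<in> polys_over A" "poly f X \<in> P" "below (Suc m) f" "coeff f m \<notin> P"
    and fmin: "\<And>g j. g \<in> polys_over A \<Longrightarrow> below m g \<Longrightarrow> poly g X \<in> P \<Longrightarrow> coeff g j \<in> P"
    using f by (auto simp: minpoly_def)
  have ev: "poly q X \<in> adjoin A X" if "q \<in> polys_over A" for q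
    using that by (auto simp: adjoin_def)
  define E where "E e \<longleftrightarrow> (\<exists>h\<in>polys_over A. coeff h e \<notin> P \<and> below (Suc e) h \<and>
      (\<exists>y\<in>adjoin A X. poly h X \<approx> s * y))" for e
  have reduce: "\<exists>e<N. E e" if r: "r \<in> polys_over A" "below N r" "poly r X \<notin> P"
    and y: "y \<in> adjoin A X" "poly r X \<approx> s * y" for r N y
  proof -
    obtain h' e where "h' \<in> polys_over A" "e < N" "below (Suc e) h'" "coeff h' e \<notin> P" "poly h' X \<approx> poly r X"
      using trim[OF r] by blast
    then show ?thesis unfolding E_def using y eqv_trans by blast
  qed
  obtain \<sigma> where \<sigma>: "\<sigma> \<in> polys_over A" "s = poly \<sigma> X"
    using s by (auto simp: adjoin_def)
  \<comment> \<open>Reducing \<open>\<sigma>\<close> by \<open>f\<close> gives a multiple of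
    \<open>s\<close> outside \<open>P\<close> of degree below \<open>m\<close>, which bounds the
    least degree \<open>e\<close>.\<close>
  obtain k q r where qr: "q \<in> polys_over A" "r \<in> polys_over A" "below m r"
      "smult (coeff f m ^ k) \<sigma> = q * f + r"
    using pseudo_division[OF fA(1,3) \<sigma>(1) below_Suc_degree] by blast
  have am: "coeff f m ^ k \<in> A" using fA by (auto simp: polys_over_def intro: power)
  have "coeff f m ^ k * s = poly q X * poly f X + poly r X"
    using arg_cong[OF qr(4), of "\<lambda>p. poly p X"] \<sigma> by simp
  then have "s * coeff f m ^ k - poly r X = poly q X * poly f X"
    by (simp add: algebra_simps)
  then have req: "s * coeff f m ^ k \<approx> poly r X"
    using fA(2) by (simp add: eqv_def P_mult)
  then have "poly r X \<notin> P"
    using not_P_mult[OF s(2) not_P_power[OF fA(4)]] eqv_P by blast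
  then obtain e0 where e0: "e0 < m" "E e0"
    using reduce[OF qr(2,3) _ _ eqv_sym[OF req]] am adjoin_superset by blast
  define e where "e = (LEAST e. E e)"
  have Ee: "E e" unfolding e_def using e0(2) by (rule LeastI)
  have em: "e < m" unfolding e_def using Least_le[of E, OF e0(2)] e0(1) by simp
  obtain h y where h: "h \<in> polys_over A" "coeff h e \<notin> P" "below (Suc e) h" "y \<in> adjoin A X"
      "poly h X \<approx> s * y"
    using Ee unfolding E_def by blast
  have "e = 0"
  proof (rule ccontr)
    assume "e \<noteq> 0"
    \<comment> \<open>The value of the remainder is again a multiple of \<open>s\<close> modulo
      \<open>P\<close>, so minimality of \<open>e\<close> puts it into \<open>P\<close>.\<close>
    obtain k q r where qr: "q \<in> polys_over A" "r \<in> polys_over A" "below e r" "below (Suc m - e) q"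
      "smult (coeff h e ^ k) f = q * h + r"
      using pseudo_division[OF h(1,3) fA(1,3)] by blast
    have qm: "below m q" using qr(4) \<open>e \<noteq> 0\<close> below_mono[of "Suc m - e" q m] by simp
    have pr: "coeff h e ^ k * poly f X = poly q X * poly h X + poly r X"
      using arg_cong[OF qr(5), of "\<lambda>p. poly p X"] by simp
    have "poly r X \<in> P"
    proof (rule ccontr)
      assume nP: "poly r X \<notin> P"
      have "poly r X - s * (- (poly q X * y)) = coeff h e ^ k * poly f X - poly q X * (poly h X - s * y)"
        using pr by (simp add: algebra_simps)
      then have "poly r X \<approx> s * (- (poly q X * y))"
        using fA(2) h(5) by (simp add: eqv_def P_diff P_mult)
      moreover have "- (poly q X * y) \<in> adjoin A X"
        by (intro B.uminus B.mult ev qr h)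
      ultimately obtain e' where "e' < e" "E e'"
        using reduce[OF qr(2,3) nP] by blast
      then show False using not_less_Least[of e' E] by (simp add: e_def)
    qed
    moreover have "poly q X * poly h X = coeff h e ^ k * poly f X - poly r X"
      using pr by (simp add: algebra_simps)
    ultimately have "poly q X * poly h X \<in> P"
      using fA(2) by (simp add: P_diff P_mult)
    moreover have "poly h X \<notin> P"
      using fmin[OF h(1), of e] h(2,3) em below_mono[OF h(3), of m] by auto
    ultimately have "poly q X \<in> P" using P_prime by blast
    then have "coeff q j \<in> P" for j
      using fmin qr(1) qm by blast
    then have "coeff (q * h) m \<in> P"
      by (auto simp: coeff_mult intro!: P_sum P_mult')
    \<comment> \<open>\<open>r\<close> has degree below \<open>e < m\<close>, so at \<open>m\<close>
      only \<open>q * h\<close> matches the leading coefficient of \<open>f\<close>.\<close>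
    moreover have "coeff (q * h) m = coeff h e ^ k * coeff f m"
      using arg_cong[OF qr(5), of "\<lambda>p. coeff p m"] qr(3) em by (simp add: below_def)
    ultimately show False
      using not_P_mult[OF not_P_power[OF h(2)] fA(4)] by auto
  qed
  then have "poly h X = coeff h 0"
    using below_1_eq[of h] h(3) by (metis poly_0 poly_pCons mult_zero_right add.right_neutral)
  then show thesis
    using that[of "coeff h 0" y] h \<open>e = 0\<close> by (auto simp: polys_over_def intro: eqv_sym)
qed

text \<open>An inverse of \<open>c\<close> up to powers of \<open>s\<close> becomes, after
  multiplication by \<open>y ^ k\<close>, an inverse up to powers of \<open>t \<in> A\<close>.
  Reducing it by the minimal polynomial and taking constant coefficients yields an inverse inside
  \<open>A\<close> up to powers of \<open>a * t\<close>.\<close>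

lemma G_domain_descend:
  assumes G: "G_domain (adjoin A X)"
  shows "G_domain A"
proof -
  interpret B: subring_of "adjoin A X" by (rule adjoin_subring)
  obtain m f where f: "minpoly A X m f" using minpoly_exists[OF G] .
  have fA: "f \<in> polys_over A" "poly f X \<in> P" "below (Suc m) f" "coeff f m \<notin> P"
    and fmin: "\<And>g j. g \<in> polys_over A \<Longrightarrow> below m g \<Longrightarrow> poly g X \<in> P \<Longrightarrow> coeff g j \<in> P"
    using f by (auto simp: minpoly_def)
  have m: "m > 0" using minpoly_pos[OF f] .
  obtain s where s: "s \<in> adjoin A X" "s \<notin> P"
    and inv: "\<And>c. c \<in> adjoin A X - P \<Longrightarrow> \<exists>k. \<exists>u\<in>adjoin A X. u * c \<approx> s ^ k"
    using G by (auto simp: G_domain_def)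
  obtain t y where t: "t \<in> A" "t \<notin> P" "y \<in> adjoin A X" "s * y \<approx> t"
    using inverse_mod_P[OF f s] .
  define a where "a = coeff f m"
  have a: "a \<in> A" "a \<notin> P" using fA by (auto simp: a_def polys_over_def)
  have "\<exists>k. \<exists>u\<in>A. u * c \<approx> (a * t) ^ k" if c: "c \<in> A - P" for c
  proof -
    obtain k u where u: "u \<in> adjoin A X" "u * c \<approx> s ^ k"
      using inv[of c] c adjoin_superset by blast
    have "u * y ^ k \<in> adjoin A X" by (intro B.mult B.power u t)
    then obtain \<eta> where \<eta>: "\<eta> \<in> polys_over A" "u * y ^ k = poly \<eta> X" by (auto simp: adjoin_def)
    have "poly \<eta> X * c = (u * c) * y ^ k" using \<eta>(2) by (simp add: mult_ac)
    also have "\<dots> \<approx> s ^ k * y ^ k" by (intro eqv_mult u) simp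
    also have "s ^ k * y ^ k = (s * y) ^ k" by (simp add: power_mult_distrib)
    also have "\<dots> \<approx> t ^ k" by (intro eqv_power t)
    finally have \<eta>c: "poly \<eta> X * c \<approx> t ^ k" .
    obtain l q r where qr: "q \<in> polys_over A" "r \<in> polys_over A" "below m r"
      "smult (a ^ l) \<eta> = q * f + r"
      using pseudo_division[OF fA(1,3) \<eta>(1) below_Suc_degree] unfolding a_def by blast
    \<comment> \<open>\<open>g\<close> has degree below \<open>m\<close>, since \<open>m > 0\<close>
      leaves room for the constant, and its value at \<open>X\<close> lies in \<open>P\<close>; so
      its constant coefficient lies in \<open>P\<close>.\<close>
    define g where "g = smult c r - [:a ^ l * t ^ k:]"
    have "g \<in> polys_over A"
      unfolding g_def using c
      by (intro Q.diff smult_polys_over const_polys_over qr mult power a t) simp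
    moreover have "below m g"
      using qr(3) m by (auto simp: g_def below_def coeff_pCons split: nat.split)
    moreover have "poly g X \<in> P"
    proof -
      have "a ^ l * poly \<eta> X = poly q X * poly f X + poly r X"
        using arg_cong[OF qr(4), of "\<lambda>p. poly p X"] by simp
      then have r: "poly r X = a ^ l * poly \<eta> X - poly q X * poly f X"
        by simp
      have "poly g X = a ^ l * (poly \<eta> X * c - t ^ k) - c * poly q X * poly f X"
        unfolding g_def by (simp add: r algebra_simps)
      then show ?thesis using \<eta>c fA(2) by (simp add: eqv_def P_diff P_mult)
    qed
    ultimately have "coeff g 0 \<in> P" by (intro fmin)
    then have g0: "c * coeff r 0 - a ^ l * t ^ k \<in> P" by (simp add: g_def)
    \<comment> \<open>The factor \<open>a ^ k * t ^ l\<close> equalises the exponents, giving a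
      power of the single element \<open>a * t\<close>.\<close>
    have "(coeff r 0 * (a ^ k * t ^ l)) * c - (a * t) ^ (k + l)
        = (a ^ k * t ^ l) * (c * coeff r 0 - a ^ l * t ^ k)"
      by (simp add: algebra_simps power_add power_mult_distrib)
    then have "(coeff r 0 * (a ^ k * t ^ l)) * c \<approx> (a * t) ^ (k + l)"
      using g0 by (simp add: eqv_def P_mult)
    moreover have "coeff r 0 * (a ^ k * t ^ l) \<in> A"
      using qr(2) by (intro mult power a t) (simp add: polys_over_def)
    ultimately show ?thesis by blast
  qed
  moreover have "a * t \<in> A - P" using a t mult not_P_mult by blast
  ultimately show ?thesis unfolding G_domain_def by blast
qed

end

section \<open>Modules with commuting derivations\<close>

text \<open>The subgroups divided out are stable under ever smaller rings, so only the group
  structure is kept fixed.\<close>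

definition additive_subgroup :: "'m::ab_group_add set \<Rightarrow> bool" where
  "additive_subgroup U \<longleftrightarrow> 0 \<in> U \<and> (\<forall>a\<in>U. \<forall>b\<in>U. a - b \<in> U)"

lemma additive_subgroup_diff: "additive_subgroup U \<Longrightarrow> a \<in> U \<Longrightarrow> b \<in> U \<Longrightarrow> a - b \<in> U"
  by (simp add: additive_subgroup_def)

lemma additive_subgroup_uminus: "additive_subgroup U \<Longrightarrow> a \<in> U \<Longrightarrow> - a \<in> U"
  using additive_subgroup_diff[of U 0 a] by (simp add: additive_subgroup_def)

lemma additive_subgroup_add: "additive_subgroup U \<Longrightarrow> a \<in> U \<Longrightarrow> b \<in> U \<Longrightarrow> a + b \<in> U"
  using additive_subgroup_diff[of U a "- b"] additive_subgroup_uminus[of U b] by simp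

lemma additive_subgroup_sum:
  "additive_subgroup U \<Longrightarrow> (\<And>i. i \<in> I \<Longrightarrow> f i \<in> U) \<Longrightarrow> sum f I \<in> U"
  by (induction I rule: infinite_finite_induct)
    (auto simp: additive_subgroup_def intro: additive_subgroup_add)

text \<open>\<open>generated\<close> replaces the concrete polynomial ring: a property holds on all
  of it once the elements having it form a subring containing \<open>k0\<close> and the
  variables.\<close>

locale weyl_action =
  fixes act :: "'r::comm_ring_1 \<Rightarrow> 'm::ab_group_add \<Rightarrow> 'm" (infixr \<open>\<odot>\<close> 75)
    and k0 :: "'r set" and X :: "'n::finite \<Rightarrow> 'r" and d :: "'n \<Rightarrow> 'm \<Rightarrow> 'm"
  assumes act_add_left: "(r + s) \<odot> m = r \<odot> m + s \<odot> m"
    and act_add: "r \<odot> (m + m') = r \<odot> m + r \<odot> m'"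
    and act_mult: "(r * s) \<odot> m = r \<odot> s \<odot> m"
    and act_one [simp]: "1 \<odot> m = m"
    and d_add: "d i (m + m') = d i m + d i m'"
    and d_commute: "d i (d j m) = d j (d i m)"
    and d_X: "d i (X j \<odot> m) = X j \<odot> d i m + (if i = j then m else 0)"
    and d_k0: "c \<in> k0 \<Longrightarrow> d i (c \<odot> m) = c \<odot> d i m"
    and k0_subring: "subring_of k0"
    and k0_inverse: "c \<in> k0 \<Longrightarrow> c \<noteq> 0 \<Longrightarrow> \<exists>c'\<in>k0. c * c' = 1"
    and char_0: "n > 0 \<Longrightarrow> of_nat n \<noteq> (0 :: 'r)"
    and generated: "subring_of A \<Longrightarrow> k0 \<subseteq> A \<Longrightarrow> range X \<subseteq> A \<Longrightarrow> A = UNIV"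
begin

lemma act_zero_right [simp]: "r \<odot> 0 = 0"
  using act_add[of r 0 0] by simp

lemma act_zero_left [simp]: "0 \<odot> m = 0"
  using act_add_left[of 0 0 m] by simp

lemma act_minus: "r \<odot> (- m) = - (r \<odot> m)"
  using act_add[of r m "- m"] by (simp add: eq_neg_iff_add_eq_0 add.commute)

lemma act_minus_left: "(- r) \<odot> m = - (r \<odot> m)"
  using act_add_left[of r "- r" m] by (simp add: eq_neg_iff_add_eq_0 add.commute)

lemma act_diff: "r \<odot> (m - m') = r \<odot> m - r \<odot> m'"
  using act_add[of r m "- m'"] by (simp add: act_minus)

lemma act_diff_left: "(r - s) \<odot> m = r \<odot> m - s \<odot> m"
  using act_add_left[of r "- s" m] by (simp add: act_minus_left)

lemma act_left_commute: "r \<odot> s \<odot> m = s \<odot> r \<odot> m"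
  by (simp add: mult.commute flip: act_mult)

lemma d_zero [simp]: "d i 0 = 0"
  using d_add[of i 0 0] by simp

lemma d_minus: "d i (- m) = - d i m"
  using d_add[of i m "- m"] by (simp add: eq_neg_iff_add_eq_0 add.commute)

lemma d_diff: "d i (m - m') = d i m - d i m'"
  using d_add[of i m "- m'"] by (simp add: d_minus)

text \<open>The head of the list is adjoined last, so dropping it is one step down in the induction
  on the variables.\<close>

primrec tower :: "'n list \<Rightarrow> 'r set" where
  "tower [] = k0"
| "tower (i # vs) = adjoin (tower vs) (X i)"

lemma tower_subring: "subring_of (tower vs)"
  by (induction vs) (auto intro: k0_subring subring_of.adjoin_subring)

lemma k0_tower: "k0 \<subseteq> tower vs"
  by (induction vs) (use subring_of.adjoin_superset[OF tower_subring] in auto)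

lemma X_tower: "i \<in> set vs \<Longrightarrow> X i \<in> tower vs"
proof (induction vs)
  case (Cons j vs)
  then show ?case
    using subring_of.adjoin_superset[OF tower_subring, of vs "X j"]
      subring_of.adjoin_gen[OF tower_subring] by auto
qed simp

lemma tower_UNIV: "set vs = UNIV \<Longrightarrow> tower vs = UNIV"
  by (intro generated tower_subring k0_tower) (auto intro: X_tower)

lemma noetherian_ring: "noetherian_set (UNIV :: 'r set)"
proof -
  have "noetherian_set (tower vs)" for vs
  proof (induction vs)
    case Nil
    show ?case using k0_inverse by (simp add: noetherian_field)
  next
    case (Cons i vs)
    then show ?case by (simp add: subring_of.noetherian_adjoin[OF tower_subring])
  qed
  moreover obtain vs where "set vs = (UNIV :: 'n set)"
    using finite_list[OF finite_UNIV] by blast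
  ultimately show ?thesis using tower_UNIV by metis
qed

section \<open>Commutation of the derivations with ring elements\<close>

lemma d_commutes_tower:
  assumes "i \<notin> set vs" "a \<in> tower vs"
  shows "d i (a \<odot> m) = a \<odot> d i m"
proof -
  define S where "S = {a. \<forall>m. d i (a \<odot> m) = a \<odot> d i m}"
  have S: "subring_of S"
    by standard (auto simp: S_def act_diff_left act_mult d_diff)
  have "tower vs \<subseteq> S"
    using assms(1)
  proof (induction vs)
    case Nil
    then show ?case using d_k0 by (auto simp: S_def)
  next
    case (Cons j vs)
    then have "X j \<in> S" by (simp add: S_def d_X)
    then show ?case
      using subring_of.adjoin_least[OF tower_subring S] Cons by simp
  qed
  then show ?thesis using assms(2) by (auto simp: S_def)
qed

text \<open>\<open>r'\<close> acts as the partial derivative of \<open>r\<close>; its existence is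
  inherited by differences and products through the Leibniz rule.\<close>

lemma commutator:
  obtains r' where "\<And>m. d i (r \<odot> m) = r \<odot> d i m + r' \<odot> m"
proof -
  define S where "S = {r. \<exists>r'. \<forall>m. d i (r \<odot> m) = r \<odot> d i m + r' \<odot> m}"
  have "S = UNIV"
  proof (rule generated)
    show "subring_of S"
    proof
      show "1 \<in> S"
        unfolding S_def by (auto intro!: exI[of _ 0])
    next
      fix a b assume "a \<in> S" "b \<in> S"
      then obtain a' b' where
        ab: "\<And>m. d i (a \<odot> m) = a \<odot> d i m + a' \<odot> m" "\<And>m. d i (b \<odot> m) = b \<odot> d i m + b' \<odot> m"
        unfolding S_def by blast
      have "d i ((a - b) \<odot> m) = (a - b) \<odot> d i m + (a' - b') \<odot> m" for m
        by (simp add: act_diff_left d_diff ab)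
      then show "a - b \<in> S" unfolding S_def by blast
      have "d i ((a * b) \<odot> m) = (a * b) \<odot> d i m + (a * b' + a' * b) \<odot> m" for m
        by (simp add: act_mult act_add_left act_add ab add.assoc)
      then show "a * b \<in> S" unfolding S_def by blast
    qed
    show "k0 \<subseteq> S"
      using d_k0 by (auto simp: S_def intro!: exI[of _ 0])
    show "range X \<subseteq> S"
      by (auto simp: S_def d_X intro!: exI[of _ "if i = _ then 1 else 0"])
  qed
  then show thesis using that unfolding S_def by blast
qed

text \<open>The coefficients of the derivative are recorded because its degree and leading
  coefficient decide whether its value lies in \<open>P\<close>.\<close>

lemma d_act_poly:
  assumes "\<And>a m. a \<in> A \<Longrightarrow> d i (a \<odot> m) = a \<odot> d i m" "subring_of A" "q \<in> polys_over A"
  shows "\<exists>q'\<in>polys_over A. (\<forall>j. coeff q' j = of_nat (Suc j) * coeff q (Suc j)) \<and>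
           (\<forall>m. d i (poly q (X i) \<odot> m) = poly q (X i) \<odot> d i m + poly q' (X i) \<odot> m)"
proof -
  interpret A: subring_of A by fact
  from assms(3) show ?thesis
  proof (induction q)
    case 0
    then show ?case by (intro bexI[of _ 0]) auto
  next
    case (pCons a p)
    have a: "a \<in> A" and p: "p \<in> polys_over A"
      using pCons.prems by (auto simp: polys_over_def coeff_pCons split: nat.splits)
    obtain p' where p': "p' \<in> polys_over A" "\<And>j. coeff p' j = of_nat (Suc j) * coeff p (Suc j)"
      "\<And>m. d i (poly p (X i) \<odot> m) = poly p (X i) \<odot> d i m + poly p' (X i) \<odot> m"
      using pCons.IH[OF p] by blast
    define q' where "q' = p + pCons 0 p'"
    have cq: "coeff q' j = of_nat (Suc j) * coeff (pCons a p) (Suc j)" for j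
      by (cases j) (auto simp: q'_def p'(2) algebra_simps)
    then have "q' \<in> polys_over A"
      using p by (auto simp: polys_over_def simp del: of_nat_Suc intro: A.mult A.of_nat)
    moreover have "d i (poly (pCons a p) (X i) \<odot> m)
        = poly (pCons a p) (X i) \<odot> d i m + poly q' (X i) \<odot> m" for m
      using assms(1)[OF a]
      by (simp add: q'_def act_add_left act_mult d_add d_X p'(3) act_add algebra_simps)
    ultimately show ?case using cq by blast
  qed
qed

lemma d_act_power:
  assumes "\<And>m. d i (g \<odot> m) = g \<odot> d i m + g' \<odot> m"
  shows "d i (g ^ Suc k \<odot> m) = g ^ Suc k \<odot> d i m + (of_nat (Suc k) * g') \<odot> g ^ k \<odot> m"
proof (induction k)
  case 0
  then show ?case by (simp add: assms)
next
  case (Suc k)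
  have "d i (g ^ Suc (Suc k) \<odot> m) = g \<odot> d i (g ^ Suc k \<odot> m) + g' \<odot> g ^ Suc k \<odot> m"
    by (simp add: act_mult assms)
  also have "\<dots> = g ^ Suc (Suc k) \<odot> d i m + (g * (of_nat (Suc k) * g') * g ^ k + g' * g ^ Suc k) \<odot> m"
    unfolding Suc by (simp add: act_mult act_add act_add_left)
  also have "g * (of_nat (Suc k) * g') * g ^ k + g' * g ^ Suc k = (of_nat (Suc (Suc k)) * g') * g ^ Suc k"
    by (simp add: algebra_simps)
  finally show ?case by (simp add: act_mult)
qed

end

section \<open>De Rham quotients of torsion modules\<close>

locale weyl_action_prime = weyl_action act k0 X d + ring_prime P
  for act :: "'r::comm_ring_1 \<Rightarrow> 'm::ab_group_add \<Rightarrow> 'm" (infixr \<open>\<odot>\<close> 75)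
    and k0 :: "'r set" and X :: "'n::finite \<Rightarrow> 'r" and d :: "'n \<Rightarrow> 'm \<Rightarrow> 'm" and P :: "'r set"
begin

text \<open>The invariant of the induction on the variables: \<open>M / U\<close> is a nonzero \<open>P\<close>-power torsion
  module over the Weyl algebra in the variables \<open>vs\<close>, on which the elements of
  \<open>K[X\<^sub>i | i \<in> vs] - P\<close> act bijectively.\<close>
definition admissible :: "'n list \<Rightarrow> 'm set \<Rightarrow> bool" where
  "admissible vs U \<longleftrightarrow> additive_subgroup U \<and> U \<noteq> UNIV \<and>
     (\<forall>a\<in>tower vs. \<forall>u\<in>U. a \<odot> u \<in> U) \<and>
     (\<forall>i\<in>set vs. \<forall>u\<in>U. d i u \<in> U) \<and>
     (\<forall>h\<in>tower vs - P. \<forall>m. h \<odot> m \<in> U \<longrightarrow> m \<in> U) \<and>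
     (\<forall>h\<in>tower vs - P. \<forall>m. \<exists>m'. h \<odot> m' - m \<in> U) \<and>
     (\<forall>g\<in>P. \<forall>m. \<exists>k. g ^ k \<odot> m \<in> U)"

text \<open>In characteristic zero a positive integer is a unit of \<open>k0\<close>, and a prime
  contains no unit.\<close>

lemma of_nat_not_P:
  assumes "n > 0"
  shows "of_nat n \<notin> P"
proof
  assume "of_nat n \<in> P"
  moreover obtain c where "of_nat n * c = (1 :: 'r)"
    using k0_inverse[OF subring_of.of_nat[OF k0_subring] char_0[OF assms]] by blast
  ultimately show False using P_mult'[of "of_nat n" c] P_1 by simp
qed

text \<open>\<open>g\<close> is the value of the minimal polynomial of \<open>X i\<close>. Its
  derivative has degree below \<open>m\<close> and leading coefficient
  \<open>of_nat m * coeff f m\<close> outside \<open>P\<close>, so minimality keeps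
  \<open>g'\<close> outside \<open>P\<close>.\<close>

lemma separating_element:
  assumes "i \<notin> set vs" "G_domain (tower (i # vs))"
  obtains g g' where "g \<in> tower (i # vs)" "g \<in> P" "g' \<in> tower (i # vs)" "g' \<notin> P"
    "\<forall>m. d i (g \<odot> m) = g \<odot> d i m + g' \<odot> m"
proof -
  interpret A: ring_prime_subring P "tower vs"
    by (intro ring_prime_subring.intro tower_subring) unfold_locales
  obtain m f where f: "minpoly (tower vs) (X i) m f"
    using A.minpoly_exists assms(2) by auto
  have fA: "f \<in> polys_over (tower vs)" "poly f (X i) \<in> P" "below (Suc m) f" "coeff f m \<notin> P"
    and fmin: "\<And>g j. g \<in> polys_over (tower vs) \<Longrightarrow> below m g \<Longrightarrow> poly g (X i) \<in> P \<Longrightarrow> coeff g j \<in> P"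
    using f by (auto simp: minpoly_def)
  obtain q where q: "q \<in> polys_over (tower vs)" "\<And>j. coeff q j = of_nat (Suc j) * coeff f (Suc j)"
    "\<And>m. d i (poly f (X i) \<odot> m) = poly f (X i) \<odot> d i m + poly q (X i) \<odot> m"
    using d_act_poly[OF d_commutes_tower[OF assms(1)] tower_subring fA(1)] by blast
  have m: "m > 0" using A.minpoly_pos[OF f] .
  have "below m q" using fA(3) by (simp add: below_def q(2))
  moreover have "coeff q (m - 1) \<notin> P"
    using q(2)[of "m - 1"] m not_P_mult[OF of_nat_not_P[OF m] fA(4)] by simp
  ultimately have "poly q (X i) \<notin> P" using fmin q(1) by blast
  then show thesis
    using that[of "poly f (X i)" "poly q (X i)"] fA q by (auto simp: adjoin_def)
qed

text \<open>\<open>d i\<close> commutes with \<open>tower vs\<close>, which carries the module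
  conditions over. Injectivity on M / V rests on surjectivity on M / U, which is why the invariant
  asks for both.\<close>

lemma admissible_step:
  assumes i: "i \<notin> set vs" and G: "G_domain (tower (i # vs))" and U: "admissible (i # vs) U"
  shows "admissible vs {u + d i w | u w. u \<in> U}"
proof -
  define V where "V = {u + d i w | u w. u \<in> U}"
  have sg: "additive_subgroup U" and ne: "U \<noteq> UNIV"
    and U_act: "\<And>a u. a \<in> tower (i # vs) \<Longrightarrow> u \<in> U \<Longrightarrow> a \<odot> u \<in> U"
    and U_d: "\<And>j u. j \<in> set (i # vs) \<Longrightarrow> u \<in> U \<Longrightarrow> d j u \<in> U"
    and inj: "\<And>h m. h \<in> tower (i # vs) \<Longrightarrow> h \<notin> P \<Longrightarrow> h \<odot> m \<in> U \<Longrightarrow> m \<in> U"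
    and surj: "\<And>h m. h \<in> tower (i # vs) \<Longrightarrow> h \<notin> P \<Longrightarrow> \<exists>m'. h \<odot> m' - m \<in> U"
    and tors: "\<And>g m. g \<in> P \<Longrightarrow> \<exists>k. g ^ k \<odot> m \<in> U"
    using U unfolding admissible_def by blast+
  note sgs = additive_subgroup_add[OF sg] additive_subgroup_diff[OF sg] additive_subgroup_uminus[OF sg]
  have U0: "0 \<in> U" using sg by (simp add: additive_subgroup_def)
  interpret T: subring_of "tower (i # vs)" by (rule tower_subring)
  have sub: "tower vs \<subseteq> tower (i # vs)"
    using subring_of.adjoin_superset[OF tower_subring] by simp
  have com: "d i (a \<odot> m) = a \<odot> d i m" if "a \<in> tower vs" for a m
    using d_commutes_tower[OF i that] .
  have VI: "u + d i w \<in> V" if "u \<in> U" for u w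
    using that by (auto simp: V_def)
  have UV: "U \<subseteq> V" using VI[of _ 0] by auto
  have "additive_subgroup V"
    unfolding additive_subgroup_def
  proof (intro conjI ballI)
    show "0 \<in> V" using UV U0 by auto
    fix a b assume "a \<in> V" "b \<in> V"
    then obtain u w u' w' where "u \<in> U" "u' \<in> U" "a = u + d i w" "b = u' + d i w'"
      by (auto simp: V_def)
    then show "a - b \<in> V"
      using VI[of "u - u'" "w - w'"] sgs by (simp add: d_diff algebra_simps)
  qed
  moreover have "V \<noteq> UNIV"
  proof
    assume V: "V = UNIV"
    obtain g g' where g: "g \<in> tower (i # vs)" "g \<in> P" "g' \<in> tower (i # vs)" "g' \<notin> P"
      "\<forall>m. d i (g \<odot> m) = g \<odot> d i m + g' \<odot> m"
      using separating_element[OF i G] .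
    obtain v where v: "v \<notin> U" using ne by auto
    \<comment> \<open>The last power not sending \<open>v\<close> into \<open>U\<close> gives a
      vector \<open>v1\<close> that is nonzero modulo \<open>U\<close> and killed by
      \<open>g\<close>.\<close>
    define k where "k = (LEAST k. g ^ k \<odot> v \<in> U)"
    have k: "g ^ k \<odot> v \<in> U" unfolding k_def using tors[OF g(2)] by (rule LeastI_ex)
    then have "k \<noteq> 0" using v by (metis act_one power_0)
    then obtain l where l: "k = Suc l" by (cases k) auto
    define v1 where "v1 = g ^ l \<odot> v"
    have v1: "v1 \<notin> U" "g \<odot> v1 \<in> U"
      using not_less_Least[of l "\<lambda>k. g ^ k \<odot> v \<in> U"] k by (auto simp: v1_def l act_mult simp flip: k_def)
    have "v1 \<in> V" using V by simp
    then obtain u w where uw: "v1 = u + d i w" "u \<in> U" by (auto simp: V_def)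
    then have gdw: "g \<odot> d i w \<in> U"
      using sgs(2)[OF v1(2) U_act[OF g(1) uw(2)]] by (simp add: act_add)
    \<comment> \<open>From \<open>g \<odot> d i w \<in> U\<close>, the Leibniz rule leaves only the
      term with \<open>of_nat (Suc k) * g'\<close>, which acts injectively modulo \<open>U\<close>;
      so the exponent drops to 0.\<close>
    have "w \<in> U" if "g ^ k \<odot> w \<in> U" for k
      using that
    proof (induction k)
      case (Suc k)
      have "d i (g ^ Suc k \<odot> w) \<in> U" using Suc.prems U_d by simp
      moreover have "g ^ Suc k \<odot> d i w \<in> U"
        using U_act[OF T.power[OF g(1), of k] gdw] by (simp add: mult.commute act_mult act_left_commute)
      ultimately have "(of_nat (Suc k) * g') \<odot> g ^ k \<odot> w \<in> U"
        using sgs(2) d_act_power[of i g g' k w] g(5) by fastforce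
      moreover have "of_nat (Suc k) * g' \<notin> P"
        by (intro not_P_mult of_nat_not_P g) simp
      ultimately have "g ^ k \<odot> w \<in> U"
        using inj[OF T.mult[OF T.of_nat g(3)]] by blast
      then show ?case by (rule Suc.IH)
    qed simp
    then have "w \<in> U" using tors[OF g(2)] by blast
    then have "v1 \<in> U" using uw U_d sgs by simp
    then show False using v1 by simp
  qed
  moreover have "a \<odot> v \<in> V" if a: "a \<in> tower vs" "v \<in> V" for a v
  proof -
    obtain u w where "v = u + d i w" "u \<in> U" using a by (auto simp: V_def)
    then show ?thesis
      using VI[of "a \<odot> u" "a \<odot> w"] U_act sub a(1) by (auto simp: act_add com)
  qed
  moreover have "d j v \<in> V" if j: "j \<in> set vs" "v \<in> V" for j v
  proof -
    obtain u w where "v = u + d i w" "u \<in> U" using j by (auto simp: V_def)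
    then show ?thesis
      using VI[of "d j u" "d j w"] U_d j(1) by (auto simp: d_add d_commute)
  qed
  moreover have "m \<in> V" if h: "h \<in> tower vs" "h \<notin> P" "h \<odot> m \<in> V" for h m
  proof -
    obtain u w where uw: "h \<odot> m = u + d i w" "u \<in> U" using h by (auto simp: V_def)
    \<comment> \<open>Dividing \<open>w\<close> by \<open>h\<close> modulo \<open>U\<close> turns
      \<open>d i w\<close> into \<open>h \<odot> d i w'\<close>, so that \<open>h\<close> can be
      cancelled.\<close>
    obtain w' where w': "h \<odot> w' - w \<in> U" using surj h sub by blast
    have "h \<odot> (m - d i w') = u - d i (h \<odot> w' - w)"
      using uw com[OF h(1)] by (simp add: act_diff d_diff)
    then have "h \<odot> (m - d i w') \<in> U" using uw sgs U_d w' by simp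
    then have "m - d i w' \<in> U" using inj h sub by blast
    from VI[OF this, of w'] show ?thesis by simp
  qed
  moreover have "\<exists>m'. h \<odot> m' - m \<in> V" if "h \<in> tower vs" "h \<notin> P" for h m
    using surj[of h m] that sub UV by blast
  moreover have "\<exists>k. g ^ k \<odot> m \<in> V" if "g \<in> P" for g m
    using tors[OF that] UV by blast
  ultimately show ?thesis
    unfolding admissible_def V_def[symmetric] by blast
qed

text \<open>Each removal of a variable needs the G-domain property of the current ring, which
  \<open>G_domain_descend\<close> passes down the tower.\<close>

lemma admissible_Nil_exists:
  assumes "distinct vs" "G_domain (tower vs)" "admissible vs U"
  shows "\<exists>V. U \<subseteq> V \<and> admissible [] V \<and> (\<forall>i\<in>set vs. \<forall>m. d i m \<in> V)"
  using assms
proof (induction vs arbitrary: U)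
  case Nil
  then show ?case by auto
next
  case (Cons i vs)
  interpret A: ring_prime_subring P "tower vs"
    by (intro ring_prime_subring.intro tower_subring) unfold_locales
  define U' where "U' = {u + d i w | u w. u \<in> U}"
  have "admissible vs U'"
    unfolding U'_def using Cons.prems by (intro admissible_step) auto
  moreover have "distinct vs" "G_domain (tower vs)"
    using Cons.prems A.G_domain_descend by auto
  ultimately obtain V where V: "U' \<subseteq> V" "admissible [] V" "\<forall>i\<in>set vs. \<forall>m. d i m \<in> V"
    using Cons.IH by blast
  have "U \<subseteq> U'"
    by (force simp: U'_def intro: exI[of _ 0])
  moreover have "0 \<in> U"
    using Cons.prems(3) by (simp add: admissible_def additive_subgroup_def)
  then have "d i m \<in> U'" for m
    unfolding U'_def by (intro CollectI exI[of _ 0] exI[of _ m]) simp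
  ultimately show ?case using V by auto
qed

end

section \<open>Maximal isolated associated primes\<close>

lemma maximal_ideal_inverse:
  fixes P :: "'a::comm_ring_1 set"
  assumes P: "maximal_ideal P" and c: "c \<notin> P"
  obtains u p where "p \<in> P" "u * c + p = 1"
proof -
  define J where "J = {u * c + p | u p. p \<in> P}"
  have J: "u * c + p \<in> J" if "p \<in> P" for u p
    using that by (auto simp: J_def)
  have Pid: "0 \<in> P" "\<And>a b. a \<in> P \<Longrightarrow> b \<in> P \<Longrightarrow> a + b \<in> P" "\<And>r a. a \<in> P \<Longrightarrow> r * a \<in> P"
    using P by (auto simp: maximal_ideal_def is_ideal_def)
  have "is_ideal J"
    unfolding is_ideal_def
  proof (intro conjI ballI allI)
    show "0 \<in> J" using J[OF Pid(1), of 0] by simp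
  next
    fix a b assume "a \<in> J" "b \<in> J"
    then obtain u p v q where "a = u * c + p" "p \<in> P" "b = v * c + q" "q \<in> P"
      by (auto simp: J_def)
    then show "a + b \<in> J" using J[of "p + q" "u + v"] Pid by (simp add: algebra_simps)
  next
    fix a r assume "a \<in> J"
    then obtain u p where "a = u * c + p" "p \<in> P" by (auto simp: J_def)
    then show "r * a \<in> J" using J[of "r * p" "r * u"] Pid by (simp add: algebra_simps)
  qed
  moreover have "P \<subseteq> J" using J[of _ 0] by auto
  moreover have "c \<in> J" using J[OF Pid(1), of 1] by simp
  ultimately have "1 \<in> J" using P c unfolding maximal_ideal_def by blast
  then show thesis using that by (auto simp: J_def)
qed

context weyl_action
begin

definition ann :: "'m \<Rightarrow> 'r set" where
  "ann m = {r. r \<odot> m = 0}"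

text \<open>The counterpart of membership in \<open>mIso_R\<close> for an abstract ring
  action.\<close>

definition max_isolated :: "'r set \<Rightarrow> bool" where
  "max_isolated P \<longleftrightarrow> prime_ideal P \<and> maximal_ideal P \<and> (\<exists>m. P = ann m) \<and>
     (\<forall>Q m. prime_ideal Q \<and> Q = ann m \<and> Q \<subseteq> P \<longrightarrow> Q = P)"

text \<open>The kernel of the localisation map \<open>M \<rightarrow> M\<^sub>P\<close>.\<close>
definition loc_kernel :: "'r set \<Rightarrow> 'm set" where
  "loc_kernel P = {m. \<exists>t. t \<notin> P \<and> t \<odot> m = 0}"

lemma ann_ideal: "is_ideal (ann m)"
  by (auto simp: is_ideal_def ann_def act_add_left act_mult)

text \<open>Otherwise the multiplicative set \<open>S\<close> generated by \<open>f\<close> and the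
  complement of \<open>P\<close> avoids \<open>ann m\<close>. An annihilator of a multiple of
  \<open>m\<close> maximal among those avoiding \<open>S\<close> is prime and lies in
  \<open>P\<close>, so it is \<open>P\<close> by isolation; but \<open>f \<in> S\<close>.\<close>

lemma loc_kernel_torsion:
  assumes P: "max_isolated P" and f: "f \<in> P"
  shows "\<exists>k. f ^ k \<odot> m \<in> loc_kernel P"
proof (rule ccontr)
  assume no: "\<nexists>k. f ^ k \<odot> m \<in> loc_kernel P"
  interpret ring_prime P using P by unfold_locales (simp add: max_isolated_def)
  define S where "S = {f ^ k * t | k t. t \<notin> P}"
  have S_mult: "a * b \<in> S" if ab: "a \<in> S" "b \<in> S" for a b
  proof -
    obtain k t l u where "a = f ^ k * t" "t \<notin> P" "b = f ^ l * u" "u \<notin> P"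
      using ab by (auto simp: S_def)
    moreover have "f ^ k * t * (f ^ l * u) = f ^ (k + l) * (t * u)"
      by (simp add: power_add mult_ac)
    ultimately show ?thesis using not_P_mult unfolding S_def by auto
  qed
  have S_not_P: "a \<in> S" if "a \<notin> P" for a
    using that unfolding S_def by (auto intro: exI[of _ 0])
  have S_f: "f \<in> S"
    using P_1 unfolding S_def by (auto intro!: exI[of _ 1])
  define \<F> where "\<F> = {ann (r \<odot> m) | r. ann (r \<odot> m) \<inter> S = {}}"
  have "ann (1 \<odot> m) \<inter> S = {}"
  proof -
    have False if "(f ^ k * t) \<odot> m = 0" "t \<notin> P" for k t
      using that no by (auto simp: loc_kernel_def mult.commute[of "f ^ k"] act_mult)
    then show ?thesis by (auto simp: ann_def S_def)
  qed
  then have "\<F> \<noteq> {}" unfolding \<F>_def by blast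
  moreover have "is_ideal I" if "I \<in> \<F>" for I
    using that ann_ideal by (auto simp: \<F>_def)
  ultimately obtain I where I: "I \<in> \<F>" and max: "\<And>J. J \<in> \<F> \<Longrightarrow> I \<subseteq> J \<Longrightarrow> J = I"
    using noetherian_maximal_element[OF noetherian_ring, of \<F>] by blast
  obtain r where r: "I = ann (r \<odot> m)" "ann (r \<odot> m) \<inter> S = {}"
    using I by (auto simp: \<F>_def)
  have grow: "I \<subseteq> ann ((a * r) \<odot> m)" for a
    by (auto simp: r ann_def act_mult act_left_commute[of _ a])
  have "prime_ideal I"
    unfolding prime_ideal_def
  proof (intro conjI allI impI)
    show "is_ideal I" by (simp add: r ann_ideal)
    show "1 \<notin> I" using r S_not_P[OF P_1] by blast
  next
    fix a b assume ab: "a * b \<in> I"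
    \<comment> \<open>If the annihilator of \<open>(a * r) \<odot> m\<close> avoids
      \<open>S\<close>, it equals \<open>I\<close> and contains \<open>b\<close>. Otherwise some
      \<open>s \<in> S\<close> kills that vector, and the annihilator of
      \<open>(s * r) \<odot> m\<close> equals \<open>I\<close> and contains
      \<open>a\<close>.\<close>
    show "a \<in> I \<or> b \<in> I"
    proof (cases "ann ((a * r) \<odot> m) \<inter> S = {}")
      case True
      then have "ann ((a * r) \<odot> m) = I" using max grow by (auto simp: \<F>_def)
      then show ?thesis
        using ab by (auto simp: r ann_def act_mult act_left_commute[of a])
    next
      case False
      then obtain s where s: "s \<in> S" "s \<odot> a \<odot> r \<odot> m = 0" by (auto simp: ann_def act_mult)
      have "t \<notin> S" if "t \<in> ann ((s * r) \<odot> m)" for t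
      proof
        assume "t \<in> S"
        then have "t * s \<in> S" using s S_mult by blast
        moreover have "t * s \<in> ann (r \<odot> m)" using that by (simp add: ann_def act_mult)
        ultimately show False using r by blast
      qed
      then have "ann ((s * r) \<odot> m) \<in> \<F>" unfolding \<F>_def by blast
      then have "ann ((s * r) \<odot> m) = I" using max grow by blast
      moreover have "a \<in> ann ((s * r) \<odot> m)"
        using s by (simp add: ann_def act_mult act_left_commute[of a])
      ultimately show ?thesis by simp
    qed
  qed
  moreover have "I \<subseteq> P" using r S_not_P by blast
  ultimately have "I = P" using P r(1) unfolding max_isolated_def by blast
  then show False using r S_f f by blast
qed

lemma loc_kernel_act: "m \<in> loc_kernel P \<Longrightarrow> r \<odot> m \<in> loc_kernel P"
  unfolding loc_kernel_def using act_left_commute[of _ r m] by force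

lemma loc_kernel_admissible:
  assumes P: "max_isolated P" and vs: "set vs = UNIV"
  shows "weyl_action_prime.admissible act k0 X d P vs (loc_kernel P)"
proof -
  interpret weyl_action_prime act k0 X d P
    using P by unfold_locales (simp add: max_isolated_def)
  have sg: "additive_subgroup (loc_kernel P)"
    unfolding additive_subgroup_def
  proof (intro conjI ballI)
    show "0 \<in> loc_kernel P" using P_1 by (auto simp: loc_kernel_def)
    fix a b assume "a \<in> loc_kernel P" "b \<in> loc_kernel P"
    then obtain t u where tu: "t \<notin> P" "t \<odot> a = 0" "u \<notin> P" "u \<odot> b = 0"
      by (auto simp: loc_kernel_def)
    then have "(t * u) \<odot> (a - b) = 0"
      by (simp add: act_diff act_mult act_left_commute[of t u a])
    then show "a - b \<in> loc_kernel P" using tu not_P_mult by (auto simp: loc_kernel_def)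
  qed
  moreover have "loc_kernel P \<noteq> UNIV"
  proof -
    obtain m where "P = ann m" using P by (auto simp: max_isolated_def)
    then have "m \<notin> loc_kernel P" by (auto simp: loc_kernel_def ann_def)
    then show ?thesis by blast
  qed
  moreover have "d i m \<in> loc_kernel P" if m: "m \<in> loc_kernel P" for i m
  proof -
    obtain t where t: "t \<notin> P" "t \<odot> m = 0" using m by (auto simp: loc_kernel_def)
    obtain t' where t': "\<And>m. d i (t \<odot> m) = t \<odot> d i m + t' \<odot> m" using commutator by blast
    \<comment> \<open>Multiplying the Leibniz rule by \<open>t\<close> once more removes the term
      with \<open>t'\<close>, so \<open>t * t\<close> kills \<open>d i m\<close>.\<close>
    have "t \<odot> (t \<odot> d i m + t' \<odot> m) = 0" using t t'[of m] by simp
    then have "(t * t) \<odot> d i m = 0"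
      using t by (simp add: act_add act_mult act_left_commute[of t t'])
    then show ?thesis using t not_P_mult by (auto simp: loc_kernel_def)
  qed
  moreover have "m \<in> loc_kernel P" if h: "h \<notin> P" "h \<odot> m \<in> loc_kernel P" for h m
  proof -
    obtain t where t: "t \<notin> P" "t \<odot> h \<odot> m = 0" using h by (auto simp: loc_kernel_def)
    then have "(t * h) \<odot> m = 0" by (simp add: act_mult)
    then show ?thesis using t h not_P_mult unfolding loc_kernel_def by blast
  qed
  moreover have "\<exists>m'. h \<odot> m' - m \<in> loc_kernel P" if h: "h \<notin> P" for h m
  proof -
    obtain u p where up: "p \<in> P" "u * h + p = 1"
      using maximal_ideal_inverse[OF _ h] P unfolding max_isolated_def by metis
    obtain k where k: "p ^ k \<odot> m \<in> loc_kernel P" using loc_kernel_torsion[OF P up(1)] by blast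
    \<comment> \<open>\<open>u * h = 1 - p\<close> and \<open>p\<close> acts nilpotently on
      \<open>m\<close> modulo the kernel, so a geometric series inverts \<open>h\<close>
      there.\<close>
    define s where "s = (\<Sum>i<k. p ^ i)"
    have "h * (u * s) = (1 - p) * s" using up(2) by (simp add: algebra_simps flip: up(2))
    also have "\<dots> = 1 - p ^ k" unfolding s_def by (rule one_diff_power_eq[symmetric])
    finally have "h \<odot> (u * s) \<odot> m - m = - (p ^ k \<odot> m)"
      by (simp add: act_diff_left flip: act_mult)
    then show ?thesis using additive_subgroup_uminus[OF sg k] by metis
  qed
  ultimately show ?thesis
    unfolding admissible_def using loc_kernel_act loc_kernel_torsion[OF P] by blast
qed

lemma loc_kernel_subgroup: "max_isolated P \<Longrightarrow> additive_subgroup (loc_kernel P)"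
proof -
  assume P: "max_isolated P"
  interpret weyl_action_prime act k0 X d P
    using P by unfold_locales (simp add: max_isolated_def)
  obtain vs where "set vs = (UNIV :: 'n set)"
    using finite_list[OF finite_UNIV] by blast
  then show ?thesis using loc_kernel_admissible[OF P] unfolding admissible_def by blast
qed

text \<open>The descent starts with all variables, where R / P is a field and thus a G-domain with
  \<open>s = 1\<close>, and ends with a proper subspace over \<open>k0\<close>.\<close>

lemma de_Rham_proper:
  assumes P: "max_isolated P"
  obtains V where "additive_subgroup V" "V \<noteq> UNIV" "loc_kernel P \<subseteq> V"
    "\<And>c v. c \<in> k0 \<Longrightarrow> v \<in> V \<Longrightarrow> c \<odot> v \<in> V" "\<And>i m. d i m \<in> V"
proof -
  interpret weyl_action_prime act k0 X d P
    using P by unfold_locales (simp add: max_isolated_def)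
  obtain vs where vs: "set vs = (UNIV :: 'n set)" "distinct vs"
    using finite_distinct_list[OF finite_UNIV] by blast
  have "\<exists>k. \<exists>u\<in>UNIV. u * c \<approx> 1 ^ k" if c: "c \<notin> P" for c
  proof -
    obtain u p where "p \<in> P" "u * c + p = 1"
      using maximal_ideal_inverse[OF _ c] P unfolding max_isolated_def by metis
    then have "u * c - 1 = - p" by (simp add: algebra_simps)
    then have "u * c \<approx> 1 ^ 0" using P_uminus[OF \<open>p \<in> P\<close>] by (simp add: eqv_def)
    then show ?thesis by blast
  qed
  then have "G_domain (tower vs)"
    unfolding G_domain_def tower_UNIV[OF vs(1)] using P_1 by blast
  then obtain V where V: "loc_kernel P \<subseteq> V" "admissible [] V" "\<forall>i\<in>set vs. \<forall>m. d i m \<in> V"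
    using admissible_Nil_exists[OF vs(2) _ loc_kernel_admissible[OF P vs(1)]] by blast
  then show thesis using that[of V] vs unfolding admissible_def by auto
qed

text \<open>Take \<open>p \<in> P\<close> with \<open>1 - p \<in> Q\<close>. Then
  \<open>r = (1 - p ^ k) ^ l\<close> works: it is 1 modulo \<open>p ^ k\<close>, which sends
  \<open>m\<close> into the kernel at \<open>P\<close>, and \<open>1 - p ^ k\<close> lies in
  \<open>Q\<close>.\<close>

lemma loc_kernel_coprime:
  assumes P: "max_isolated P" and Q: "max_isolated Q" and "P \<noteq> Q"
  obtains r where "r \<odot> m \<in> loc_kernel Q" "r \<odot> m - m \<in> loc_kernel P"
proof -
  have mP: "maximal_ideal P" and mQ: "maximal_ideal Q"
    using P Q by (auto simp: max_isolated_def)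
  have "\<not> Q \<subseteq> P" using mP mQ \<open>P \<noteq> Q\<close> unfolding maximal_ideal_def by blast
  then obtain q where q: "q \<in> Q" "q \<notin> P" by blast
  obtain u p where p: "p \<in> P" "u * q + p = 1" using maximal_ideal_inverse[OF mP q(2)] .
  obtain k where k: "p ^ k \<odot> m \<in> loc_kernel P" using loc_kernel_torsion[OF P p(1)] by blast
  have "1 - p ^ k = (1 - p) * (\<Sum>i<k. p ^ i)" by (rule one_diff_power_eq)
  also have "\<dots> = (u * (\<Sum>i<k. p ^ i)) * q" using p(2) by (simp add: algebra_simps flip: p(2))
  finally have "1 - p ^ k \<in> Q" using mQ q(1) by (simp add: maximal_ideal_def is_ideal_def)
  then obtain l where l: "(1 - p ^ k) ^ l \<odot> m \<in> loc_kernel Q" using loc_kernel_torsion[OF Q] by blast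
  define c where "c = (\<Sum>i<l. (1 - p ^ k) ^ i)"
  have "1 - (1 - p ^ k) ^ l = c * p ^ k"
    using one_diff_power_eq[of "1 - p ^ k" l] by (simp add: c_def mult.commute)
  then have "(1 - p ^ k) ^ l \<odot> m - m = - (c \<odot> p ^ k \<odot> m)"
    by (metis act_diff_left act_mult act_one minus_diff_eq)
  then have "(1 - p ^ k) ^ l \<odot> m - m \<in> loc_kernel P"
    using additive_subgroup_uminus[OF loc_kernel_subgroup[OF P] loc_kernel_act[OF k]] by simp
  with l show thesis by (rule that)
qed

text \<open>The primes are treated one at a time; multiplying by a further ring element preserves
  membership in the kernels already reached.\<close>

lemma loc_kernel_CRT:
  assumes "finite \<Q>" and P: "max_isolated P" and "\<And>Q. Q \<in> \<Q> \<Longrightarrow> max_isolated Q \<and> P \<noteq> Q"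
  shows "\<exists>m'. m' - m \<in> loc_kernel P \<and> (\<forall>Q\<in>\<Q>. m' \<in> loc_kernel Q)"
  using assms(1,3)
proof (induction \<Q>)
  case empty
  show ?case
    using loc_kernel_subgroup[OF P] by (intro exI[of _ m]) (simp add: additive_subgroup_def)
next
  case (insert Q \<Q>)
  then obtain m' where m': "m' - m \<in> loc_kernel P" "\<forall>Q\<in>\<Q>. m' \<in> loc_kernel Q" by blast
  obtain r where r: "r \<odot> m' \<in> loc_kernel Q" "r \<odot> m' - m' \<in> loc_kernel P"
    using loc_kernel_coprime[OF P, of Q m'] insert.prems by blast
  have "r \<odot> m' - m \<in> loc_kernel P"
    using additive_subgroup_add[OF loc_kernel_subgroup[OF P] r(2) m'(1)] by simp
  then show ?case using r m' loc_kernel_act by (intro exI[of _ "r \<odot> m'"]) auto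
qed

text \<open>Since each \<open>V P\<close> contains the kernel at \<open>P\<close>, vectors chosen by
  the Chinese remainder argument are dual to the family \<open>V\<close>.\<close>

lemma dual_family:
  assumes "finite \<P>" "\<forall>P\<in>\<P>. max_isolated P"
  shows "\<exists>v V. \<forall>P\<in>\<P>. additive_subgroup (V P) \<and> (\<forall>c\<in>k0. \<forall>m\<in>V P. c \<odot> m \<in> V P) \<and>
    (\<forall>i m. d i m \<in> V P) \<and> v P \<notin> V P \<and> (\<forall>Q\<in>\<P> - {P}. v P \<in> V Q)"
proof -
  have "\<forall>P\<in>\<P>. \<exists>V. additive_subgroup V \<and> V \<noteq> UNIV \<and> loc_kernel P \<subseteq> V \<and>
      (\<forall>c\<in>k0. \<forall>v\<in>V. c \<odot> v \<in> V) \<and> (\<forall>i m. d i m \<in> V)"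
    using assms(2) de_Rham_proper by metis
  then obtain V where V: "\<And>P. P \<in> \<P> \<Longrightarrow> additive_subgroup (V P) \<and> V P \<noteq> UNIV \<and> loc_kernel P \<subseteq> V P \<and>
      (\<forall>c\<in>k0. \<forall>v\<in>V P. c \<odot> v \<in> V P) \<and> (\<forall>i m. d i m \<in> V P)"
    by metis
  have "\<exists>v. v \<notin> V P \<and> (\<forall>Q\<in>\<P> - {P}. v \<in> V Q)" if P: "P \<in> \<P>" for P
  proof -
    obtain m where m: "m \<notin> V P" using V[OF P] by blast
    obtain v where v: "v - m \<in> loc_kernel P" "\<forall>Q\<in>\<P> - {P}. v \<in> loc_kernel Q"
      using loc_kernel_CRT[of "\<P> - {P}" P m] assms P by auto
    have "v \<notin> V P"
    proof
      assume "v \<in> V P"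
      then have "v - (v - m) \<in> V P"
        using V[OF P] v(1) additive_subgroup_diff[of "V P" v "v - m"] by blast
      then show False using m by simp
    qed
    then show ?thesis using v V by blast
  qed
  then obtain v where "\<And>P. P \<in> \<P> \<Longrightarrow> v P \<notin> V P \<and> (\<forall>Q\<in>\<P> - {P}. v P \<in> V Q)"
    by metis
  with V show ?thesis by (intro exI[of _ v] exI[of _ V]) blast
qed

end

section \<open>The polynomial ring acting on a Weyl module\<close>

lemma poly_mapping_induct_single_add:
  assumes "\<And>k v. R (Poly_Mapping.single k v)" "\<And>p q. R p \<Longrightarrow> R q \<Longrightarrow> R (p + q)"
  shows "R (p :: 'a \<Rightarrow>\<^sub>0 'b::comm_monoid_add)"
proof (induction p rule: update_induct)
  case const
  show ?case using assms(1)[of undefined 0] by simp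
next
  case (update f a b)
  have "Poly_Mapping.update a b f = f + Poly_Mapping.single a b"
    using update(1) by (intro poly_mapping_eqI) (auto simp: lookup_update lookup_add lookup_single in_keys_iff)
  then show ?case using assms update by simp
qed

section \<open>Monomials acting through commuting operators\<close>

context
  fixes x :: "'n::finite \<Rightarrow> 'm::ab_group_add \<Rightarrow> 'm"
  assumes commute: "\<And>i j m. x i (x j m) = x j (x i m)"
begin

lemma funpow_x_commute: "(x i ^^ a) ((x j ^^ b) m) = (x j ^^ b) ((x i ^^ a) m)"
proof -
  have step: "(x i ^^ a) (x j m) = x j ((x i ^^ a) m)" for m
    by (induction a) (auto simp: commute)
  show ?thesis by (induction b) (auto simp: step)
qed

lemma comp_fun_commute_mono_act:
  "comp_fun_commute_on UNIV (\<lambda>i f. (x i ^^ Poly_Mapping.lookup \<mu> i) \<circ> f)"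
  by standard (auto simp: fun_eq_iff funpow_x_commute)

text \<open>\<open>mono_act\<close> with an arbitrary index set, to allow induction over that
  set.\<close>

definition partial_mono_act :: "'n set \<Rightarrow> ('n \<Rightarrow>\<^sub>0 nat) \<Rightarrow> 'm \<Rightarrow> 'm" where
  "partial_mono_act S \<mu> = Finite_Set.fold (\<lambda>i f. (x i ^^ Poly_Mapping.lookup \<mu> i) \<circ> f) id S"

lemma partial_mono_act_empty [simp]: "partial_mono_act {} \<mu> m = m"
  by (simp add: partial_mono_act_def)

lemma partial_mono_act_insert [simp]:
  "finite S \<Longrightarrow> i \<notin> S \<Longrightarrow>
     partial_mono_act (insert i S) \<mu> m = (x i ^^ Poly_Mapping.lookup \<mu> i) (partial_mono_act S \<mu> m)"
  unfolding partial_mono_act_def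
  by (simp add: comp_fun_commute_on.fold_insert[OF comp_fun_commute_mono_act])

lemma partial_mono_act_commute:
  "finite S \<Longrightarrow> partial_mono_act S \<mu> ((x i ^^ a) m) = (x i ^^ a) (partial_mono_act S \<mu> m)"
  by (induction S rule: finite_induct) (auto simp: funpow_x_commute)

lemma mono_act_add: "mono_act x (\<mu> + \<nu>) m = mono_act x \<mu> (mono_act x \<nu> m)"
proof -
  have "partial_mono_act S (\<mu> + \<nu>) m = partial_mono_act S \<mu> (partial_mono_act S \<nu> m)" if "finite S" for S
    using that
    by (induction S rule: finite_induct) (auto simp: lookup_add funpow_add partial_mono_act_commute intro: funpow_x_commute)
  then show ?thesis by (simp add: mono_act_def partial_mono_act_def)
qed

lemma mono_act_zero [simp]: "mono_act x 0 m = m"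
proof -
  have "partial_mono_act S 0 m = m" if "finite S" for S
    using that by (induction S rule: finite_induct) auto
  then show ?thesis by (simp add: mono_act_def partial_mono_act_def)
qed

lemma mono_act_single [simp]: "mono_act x (Poly_Mapping.single i (Suc 0)) m = x i m"
proof -
  have "partial_mono_act S (Poly_Mapping.single i (Suc 0)) m = (if i \<in> S then x i m else m)" if "finite S" for S
    using that by (induction S rule: finite_induct) (auto simp: lookup_single when_def)
  then show ?thesis by (simp add: mono_act_def partial_mono_act_def)
qed

lemma mono_act_commute:
  assumes "\<And>i m. x i (s m) = s (x i m)"
  shows "mono_act x \<mu> (s m) = s (mono_act x \<mu> m)"
proof -
  have pow: "(x i ^^ a) (s m) = s ((x i ^^ a) m)" for i a m
    by (induction a) (auto simp: assms)
  have "partial_mono_act S \<mu> (s m) = s (partial_mono_act S \<mu> m)" if "finite S" for S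
    using that by (induction S rule: finite_induct) (auto simp: pow)
  then show ?thesis by (simp add: mono_act_def partial_mono_act_def)
qed

lemma mono_act_plus:
  assumes "\<And>i m m'. x i (m + m') = x i m + x i m'"
  shows "mono_act x \<mu> (m + m') = mono_act x \<mu> m + mono_act x \<mu> m'"
proof -
  have pow: "(x i ^^ a) (m + m') = (x i ^^ a) m + (x i ^^ a) m'" for i a m m'
    by (induction a) (auto simp: assms)
  have "partial_mono_act S \<mu> (m + m') = partial_mono_act S \<mu> m + partial_mono_act S \<mu> m'"
    if "finite S" for S
    using that by (induction S rule: finite_induct) (auto simp: pow)
  then show ?thesis by (simp add: mono_act_def partial_mono_act_def)
qed

end

section \<open>Generators of the polynomial ring and the induced action\<close>

definition const_polys :: "(('n \<Rightarrow>\<^sub>0 nat) \<Rightarrow>\<^sub>0 'k::field) set" where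
  "const_polys = range (Poly_Mapping.single 0)"

definition var :: "'n \<Rightarrow> ('n \<Rightarrow>\<^sub>0 nat) \<Rightarrow>\<^sub>0 'k::field" where
  "var i = Poly_Mapping.single (Poly_Mapping.single i 1) 1"

lemma const_polys_subring: "subring_of const_polys"
proof
  show "1 \<in> const_polys" by (metis const_polys_def rangeI single_one)
next
  fix a b :: "('a \<Rightarrow>\<^sub>0 nat) \<Rightarrow>\<^sub>0 'b" assume "a \<in> const_polys" "b \<in> const_polys"
  then obtain c e where "a = Poly_Mapping.single 0 c" "b = Poly_Mapping.single 0 e"
    by (auto simp: const_polys_def)
  then have "a - b = Poly_Mapping.single 0 (c - e)" "a * b = Poly_Mapping.single 0 (c * e)"
    by (simp_all add: single_diff mult_single)
  then show "a - b \<in> const_polys" "a * b \<in> const_polys" by (simp_all add: const_polys_def)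
qed

lemma const_polys_inverse:
  assumes "c \<in> const_polys" "c \<noteq> 0"
  shows "\<exists>c'\<in>const_polys. c * c' = 1"
proof -
  obtain a where "c = Poly_Mapping.single 0 a" using assms by (auto simp: const_polys_def)
  moreover from this have "a \<noteq> 0" using assms by auto
  ultimately have "c * Poly_Mapping.single 0 (inverse a) = 1" by (simp add: mult_single)
  then show ?thesis by (auto simp: const_polys_def)
qed

lemma const_var_generate:
  assumes "subring_of A" "const_polys \<subseteq> A" "range var \<subseteq> A"
  shows "A = UNIV"
proof -
  interpret A: subring_of A by fact
  have var_power: "var i ^ n = Poly_Mapping.single (Poly_Mapping.single i n) 1" for i n
    by (induction n) (auto simp: var_def mult_single simp flip: single_add)
  have monomial: "Poly_Mapping.single \<mu> 1 \<in> A" for \<mu>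
  proof (induction \<mu> rule: poly_mapping_induct_single_add)
    case (1 i n)
    have "var i ^ n \<in> A" using assms by (intro A.power) auto
    then show ?case by (simp add: var_power)
  next
    case (2 \<mu> \<nu>)
    then have "Poly_Mapping.single \<mu> 1 * Poly_Mapping.single \<nu> 1 \<in> A" by (rule A.mult)
    then show ?case by (simp add: mult_single)
  qed
  have "p \<in> A" for p
  proof (induction p rule: poly_mapping_induct_single_add)
    case (1 \<mu> c)
    have "Poly_Mapping.single 0 c * Poly_Mapping.single \<mu> 1 \<in> A"
      using assms monomial by (intro A.mult) (auto simp: const_polys_def)
    then show ?case by (simp add: mult_single)
  next
    case (2 p q)
    then show ?case by (rule A.add)
  qed
  then show ?thesis by blast
qed

lemma weyl_module_action:
  fixes scale :: "'k::field_char_0 \<Rightarrow> 'm::ab_group_add \<Rightarrow> 'm" and x d :: "'n::finite \<Rightarrow> 'm \<Rightarrow> 'm"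
  assumes W: "weyl_module scale x d"
  shows "weyl_action (poly_act scale x) const_polys var d"
    and "poly_act scale x (Poly_Mapping.single 0 c) m = scale c m"
proof -
  interpret vector_space scale using W by (simp add: weyl_module_def)
  have comm: "\<And>i j m. x i (x j m) = x j (x i m)"
    and dd: "\<And>i j m. d i (d j m) = d j (d i m)"
    and dx: "\<And>i j m. d i (x j m) = x j (d i m) + (if i = j then m else 0)"
    using W unfolding weyl_module_def by blast+
  have x_add: "\<And>i m m'. x i (m + m') = x i m + x i m'" and x_scale: "\<And>i c m. x i (scale c m) = scale c (x i m)"
    and d_add: "\<And>i m m'. d i (m + m') = d i m + d i m'" and d_scale: "\<And>i c m. d i (scale c m) = scale c (d i m)"
    using W unfolding weyl_module_def Vector_Spaces.linear_iff by blast+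
  have mono_add: "mono_act x \<mu> (m + m') = mono_act x \<mu> m + mono_act x \<mu> m'" for \<mu> m m'
    by (rule mono_act_plus[of x, OF comm x_add])
  have mono_scale: "mono_act x \<mu> (scale c m) = scale c (mono_act x \<mu> m)" for \<mu> c m
    by (rule mono_act_commute[of x "scale c", OF comm x_scale])
  let ?act = "poly_act scale x"
  \<comment> \<open>A common index set is needed to compare \<open>p\<close>, \<open>q\<close> and
    \<open>p + q\<close>, whose keys may cancel.\<close>
  have superset: "?act p m = (\<Sum>\<mu>\<in>S. scale (Poly_Mapping.lookup p \<mu>) (mono_act x \<mu> m))"
    if "finite S" "Poly_Mapping.keys p \<subseteq> S" for p S m
    unfolding poly_act_def using that
    by (intro sum.mono_neutral_left) (auto simp: in_keys_iff)
  have single: "?act (Poly_Mapping.single \<mu> c) m = scale c (mono_act x \<mu> m)" for \<mu> c m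
    by (subst superset[of "{\<mu>}"]) auto
  have add_left: "?act (p + q) m = ?act p m + ?act q m" for p q m
  proof -
    let ?S = "Poly_Mapping.keys p \<union> Poly_Mapping.keys q"
    have "?act (p + q) m = (\<Sum>\<mu>\<in>?S. scale (Poly_Mapping.lookup (p + q) \<mu>) (mono_act x \<mu> m))"
      using keys_add[of p q] by (intro superset) auto
    also have "\<dots> = ?act p m + ?act q m"
      by (simp add: superset[of ?S] lookup_add scale_left_distrib sum.distrib)
    finally show ?thesis .
  qed
  have add_right: "?act p (m + m') = ?act p m + ?act p m'" for p m m'
    by (simp add: poly_act_def mono_add scale_right_distrib sum.distrib)
  have mult: "?act (p * q) m = ?act p (?act q m)" for p q m
  proof (induction p rule: poly_mapping_induct_single_add)
    case (1 \<mu> c)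
    show ?case
    proof (induction q rule: poly_mapping_induct_single_add)
      case (1 \<nu> e)
      show ?case by (simp add: mult_single single mono_scale mono_act_add[of x, OF comm])
    next
      case (2 p q)
      then show ?case by (simp add: distrib_left add_left add_right)
    qed
  next
    case (2 p q)
    then show ?case by (simp add: distrib_right add_left)
  qed
  have scalar: "?act (Poly_Mapping.single 0 c) m = scale c m" for c m
    by (simp add: single mono_act_zero[of x, OF comm])
  then show "?act (Poly_Mapping.single 0 c) m = scale c m" .
  have vx: "?act (var i) m = x i m" for i m
    by (simp add: var_def single mono_act_single[of x, OF comm])
  show "weyl_action ?act const_polys var d"
  proof (rule weyl_action.intro)
    show "?act 1 m = m" for m
      using scalar[of 1 m] by simp
    show "d i (m + m') = d i m + d i m'" for i m m'
      by (rule d_add)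
    show "d i (?act c m) = ?act c (d i m)" if "c \<in> const_polys" for c i m
      using that by (auto simp: d_scale const_polys_def scalar)
    show "of_nat n \<noteq> (0 :: ('n \<Rightarrow>\<^sub>0 nat) \<Rightarrow>\<^sub>0 'k)" if "n > 0" for n
      using that by simp
  qed (simp_all add: add_left add_right mult dd dx vx const_polys_subring const_polys_inverse
      const_var_generate)
qed

section \<open>Counting the maximal isolated primes\<close>

theorem theorem5:
  fixes scale :: "'k::field_char_0 \<Rightarrow> 'm::ab_group_add \<Rightarrow> 'm"
    and x d :: "'n::finite \<Rightarrow> 'm \<Rightarrow> 'm"
    and B :: "'m set"
  assumes "holonomic scale x d"
    and "quot_basis scale (dR_image d) B"
  shows "finite (mIso_R scale x) \<and> card (mIso_R scale x) \<le> card B"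
proof -
  have W: "weyl_module scale x d" using assms(1) by (simp add: holonomic_def)
  interpret V: vector_space scale using W by (simp add: weyl_module_def)
  interpret weyl_action "poly_act scale x" const_polys var d by (rule weyl_module_action[OF W])
  note scalar = weyl_module_action(2)[OF W]
  have B: "finite B" "V.span (dR_image d \<union> B) = UNIV"
    using assms(2) by (auto simp: quot_basis_def)
  have isolated: "max_isolated P" if "P \<in> mIso_R scale x" for P
    using that by (auto simp: mIso_R_def Ass_R_def R_ann_def max_isolated_def ann_def)
  \<comment> \<open>A uniform bound on finite subsets gives finiteness of \<open>mIso_R\<close> as
    well as the bound on its size.\<close>
  have "card \<P> \<le> card B" if sub: "\<P> \<subseteq> mIso_R scale x" and fin: "finite \<P>" for \<P>
  proof -
    have "\<forall>P\<in>\<P>. max_isolated P" using sub isolated by blast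
    from dual_family[OF fin this] obtain v U where vU: "\<forall>P\<in>\<P>. additive_subgroup (U P) \<and>
        (\<forall>c\<in>const_polys. \<forall>m\<in>U P. poly_act scale x c m \<in> U P) \<and> (\<forall>i m. d i m \<in> U P) \<and>
        v P \<notin> U P \<and> (\<forall>Q\<in>\<P> - {P}. v P \<in> U Q)"
      by (elim exE) (rule that)
    then have U: "\<And>P. P \<in> \<P> \<Longrightarrow> additive_subgroup (U P)"
      "\<And>P c m. P \<in> \<P> \<Longrightarrow> c \<in> const_polys \<Longrightarrow> m \<in> U P \<Longrightarrow> poly_act scale x c m \<in> U P"
      "\<And>P i m. P \<in> \<P> \<Longrightarrow> d i m \<in> U P"
      and v: "\<And>P. P \<in> \<P> \<Longrightarrow> v P \<notin> U P"
      "\<And>P Q. P \<in> \<P> \<Longrightarrow> Q \<in> \<P> \<Longrightarrow> P \<noteq> Q \<Longrightarrow> v P \<in> U Q"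
      by auto
    have U_sub: "V.subspace (U P)" if "P \<in> \<P>" for P
      unfolding V.subspace_def
    proof (intro conjI ballI allI)
      show "0 \<in> U P" using U(1)[OF that] by (simp add: additive_subgroup_def)
      show "a + b \<in> U P" if "a \<in> U P" "b \<in> U P" for a b
        using additive_subgroup_add[OF U(1)[OF \<open>P \<in> \<P>\<close>] that] .
      show "scale c a \<in> U P" if "a \<in> U P" for c a
        using U(2)[OF \<open>P \<in> \<P>\<close> _ that, of "Poly_Mapping.single 0 c"] scalar by (simp add: const_polys_def)
    qed
    have dR: "dR_image d \<subseteq> U P" if "P \<in> \<P>" for P
      using U(3)[OF that] by (auto simp: dR_image_def intro!: additive_subgroup_sum[OF U(1)[OF that]])
    \<comment> \<open>Every \<open>U Q\<close> contains the De Rham image, so \<open>v P\<close> may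
      be replaced by its component in the span of \<open>B\<close> without losing duality.\<close>
    have "\<exists>w\<in>V.span B. \<forall>Q\<in>\<P>. v P - w \<in> U Q" for P
    proof -
      obtain n w where nw: "v P = n + w" "n \<in> V.span (dR_image d)" "w \<in> V.span B"
        using B(2) V.span_Un[of "dR_image d" B] by blast
      then have "n \<in> U Q" if "Q \<in> \<P>" for Q
        using V.span_minimal[OF dR U_sub] that by blast
      then show ?thesis using nw by (intro bexI[of _ w]) auto
    qed
    then obtain w where w: "\<And>P. w P \<in> V.span B" "\<And>P Q. Q \<in> \<P> \<Longrightarrow> v P - w P \<in> U Q"
      by metis
    have diag: "w P \<notin> U P" if "P \<in> \<P>" for P
      using additive_subgroup_add[OF U(1)[OF that] w(2)[OF that, of P], of "w P"] v(1)[OF that] by auto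
    have off: "w P \<in> U Q" if "P \<in> \<P>" "Q \<in> \<P>" "P \<noteq> Q" for P Q
      using additive_subgroup_diff[OF U(1)[OF that(2)] v(2)[OF that] w(2)[OF that(2), of P]] by simp
    have "inj_on w \<P>"
      using diag off by (metis inj_onI)
    \<comment> \<open>The subspace \<open>U P\<close> contains all other vectors of the family but
      not \<open>w P\<close>, so \<open>w P\<close> is not in their span.\<close>
    moreover have "V.independent (w ` \<P>)"
      unfolding V.dependent_def
    proof safe
      fix P assume P: "P \<in> \<P>" and dep: "w P \<in> V.span (w ` \<P> - {w P})"
      have "w ` \<P> - {w P} \<subseteq> U P" using off P by auto
      then show False using V.span_minimal[OF _ U_sub[OF P]] dep diag[OF P] by blast
    qed
    ultimately show ?thesis
      using V.independent_span_bound[OF B(1), of "w ` \<P>"] w(1) by (auto simp: card_image)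
  qed
  then show ?thesis by (intro finite_if_finite_subsets_card_bdd) auto
qed

end
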